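(* Let $X_1,\dots,X_n$ be i.i.d. with density $f\in L_2[0,1]$, let $\{\varphi_i\}_{i\in\mathbb N}$ be an orthonormal basis of $L_2[0,1]$ with $\sup_{x}|\varphi_i(x)|\le c_\varphi$ for all $i$, let $\theta=(\theta_i)_{i\in\mathbb N}\in\ell_2$, $\theta_i=\int_0^1\varphi_i f$, $Y_i=\frac1n\sum_{l=1}^n\varphi_i(X_l)$, and let $\sigma_n\in(0,1]$. Write $\mathbb P_\theta,\mathbb E_\theta$ for the probability and expectation under $f$, and let $\hat\pi,\hat\theta,\hat r,r^2(I,\theta),r^2(\theta),\Theta_{\rm eb}(t)$ be as in the context. Put $\alpha=\min\{1,1/(2c_\varphi^2)\}$, $c_2=\alpha/16$, $c_3=6/\alpha+4\varkappa$, $C_\nu=e^\nu/(e^\nu-1)$. Then there exist constants $M_0,M_1,M_2,M_3,H_0,H_1,H_2,H_3,m_0,m_1,m_2,m_3>0$, not depending on $n$, $\sigma_n$, $\theta$, such that for any $M,t\ge0$, with $\hat R_M^2=(t+1)M_2\hat r^2+(t+2)M\sigma_n^2$, $$\sup_\theta\mathbb E_\theta\hat\pi\big(\|\theta-\vartheta\|^2\ge M_0r^2(\theta)+M\sigma_n^2|Y\big)\le2e^{-n\sigma_n^2+\log n}+H_0e^{-m_0M},$$ $$\sup_\theta\mathbb P_\theta\big(\|\hat\theta-\theta\|^2\ge M_1r^2(\theta)+M\sigma_n^2\big)\le2e^{-n\sigma_n^2+\log n}+H_1e^{-m_1M},$$ $$\sup_\theta\mathbb E_\theta\hat\pi\big(I:\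 r^2(I,\theta)\ge c_3r^2(\theta)+M\sigma_n^2|Y\big)\le2e^{-n\sigma_n^2+\log n}+C_\nu e^{-c_2M},$$ $$\sup_\theta\mathbb P_\theta\big(\hat r^2\ge M_3r^2(\theta)+(M+1)\sigma_n^2\big)\le2e^{-n\sigma_n^2+\log n}+H_3e^{-m_3M},$$ $$\sup_{\theta\in\Theta_{\rm eb}(t)}\mathbb P_\theta\big(\theta\notin B(\hat\theta,\hat R_M)\big)\le2e^{-n\sigma_n^2+\log n}+H_2e^{-m_2M},$$ where the suprema are over $\theta\in\ell_2$ (in the last line additionally $\theta\in\Theta_{\rm eb}(t)$) that are coefficient sequences of densities on $[0,1]$.
   Context: $\|\cdot\|$ is the $\ell_2$-norm and $B(\theta_0,R)=\{\theta\in\ell_2:\|\theta-\theta_0\|\le R\}$. Structures: $I\in\mathcal I=\{0,1,\dots,n\}$, $\mathbb L_I=\{x\in\ell_2:x_i=0\text{ for all }i\ge I+1\}$, $\mathrm P_I$ keeps the first $I$ coordinates and sets the others to $0$; $d_I=\rho(I)=I$. With $\nu>0$ fixed, $\sum_{I}e^{-\nu\rho(I)}\le C_\nu=e^\nu/(e^\nu-1)$. Fix $\varkappa>(32\nu+10+\alpha)/(4\alpha)$. Data dependent measures: $$\tilde\pi(I|Y)=\frac{e^{-\varkappa I}\exp\{\|\mathrm P_IY\|^2/(2\sigma_n^2)\}}{\sum_{J=0}^ne^{-\varkappa J}\exp\{\|\mathrm P_JY\|^2/(2\sigma_n^2)\}},\quad I\in\mathcal I.$$ Let $Z=(Z_i)$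 have an arbitrary fixed mean-zero law $\mathbb P_Z$ with $\mathbb E_Z\exp\{\alpha\|\mathrm P_IZ\|^2\}\le e^{I}$ for all $I\in\mathcal I$; $\tilde\pi_I(\vartheta\in B|Y)=\mathbb P_Z(\mathrm P_Iy+\sigma_n\mathrm P_IZ\in B)|_{y=Y}$. Then $\tilde\pi(\vartheta|Y)=\sum_I\tilde\pi_I(\vartheta|Y)\tilde\pi(I|Y)$, $\tilde\theta=\sum_I(\mathrm P_IY)\tilde\pi(I|Y)$; $\hat I\in\arg\max_I\tilde\pi(I|Y)$; $\check\pi(I|Y)=1\{I=\hat I\}$, $\check\pi(\vartheta|Y)=\tilde\pi_{\hat I}(\vartheta|Y)$, $\check\theta=\mathrm P_{\hat I}Y$. $(\hat\pi,\hat\theta)$ denotes either $(\tilde\pi,\tilde\theta)$ or $(\check\pi,\check\theta)$ (the statement holds for both). $\hat r^2=\sigma_n^2+\sigma_n^2\hat I$. Rates: $r^2(I,\theta)=\sum_{i\ge I+1}\theta_i^2+\sigma_n^2I$, $r^2(\theta)=\min_{I\in\mathcal I}r^2(I,\theta)$. Put $\bar\tau=3(1+\varkappa\alpha)/\alpha$, fix $\delta\in(0,1)$ and $\tau_0>\frac{1+\delta}{1-\delta}\bar\tau$; let $I_*=I_*(\theta)$ be a minimizer over $I\in\mathcal I$ of $\sum_{i\ge I+1}\theta_i^2+\tau_0\sigma_n^2I$; $\Theta_{\rm eb}(t)=\{\theta\in\ell_2:\sum_{i\ge I_*+1}\theta_i^2\le t\sigma_n^2(1+I_* )\}$. *)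

theory Defs
  imports "HOL-Probability.Probability"
begin

(* Sequences are functions on nat; the i-th coordinate (i = 1, 2, ...) of the mathematical
   sequence is the value at i - 1.  So "the first I coordinates" are the positions i < I and
   the sum over i >= I + 1 runs over the positions I, I + 1, .... *)

definition ell2 :: "(nat \<Rightarrow> real) set" where
  "ell2 = {x. summable (\<lambda>i. (x i)\<^sup>2)}"

definition l2norm :: "(nat \<Rightarrow> real) \<Rightarrow> real" where
  "l2norm x = sqrt (\<Sum>i. (x i)\<^sup>2)"

definition l2dist :: "(nat \<Rightarrow> real) \<Rightarrow> (nat \<Rightarrow> real) \<Rightarrow> real" where
  "l2dist x y = l2norm (\<lambda>i. x i - y i)"

definition l2ball :: "(nat \<Rightarrow> real) \<Rightarrow> real \<Rightarrow> (nat \<Rightarrow> real) set" where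
  "l2ball \<theta>0 R = {\<theta> \<in> ell2. l2dist \<theta> \<theta>0 \<le> R}"

definition proj :: "nat \<Rightarrow> (nat \<Rightarrow> real) \<Rightarrow> nat \<Rightarrow> real" where
  "proj I x = (\<lambda>i. if i < I then x i else 0)"

(* Elements of L_2[0,1] are represented by Borel functions on [0,1]; their values outside [0,1]
   are irrelevant. *)

abbreviation unit_lborel :: "real measure" where
  "unit_lborel \<equiv> restrict_space lborel {0..1}"

definition L2_unit :: "(real \<Rightarrow> real) set" where
  "L2_unit = {g \<in> borel_measurable unit_lborel. integrable unit_lborel (\<lambda>x. (g x)\<^sup>2)}"

definition inner_unit :: "(real \<Rightarrow> real) \<Rightarrow> (real \<Rightarrow> real) \<Rightarrow> real" where
  "inner_unit g h = (LINT x|unit_lborel. g x * h x)"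

definition orthonormal_basis_unit :: "(nat \<Rightarrow> real \<Rightarrow> real) \<Rightarrow> bool" where
  "orthonormal_basis_unit \<phi> \<longleftrightarrow>
     (\<forall>i. \<phi> i \<in> L2_unit) \<and>
     (\<forall>i j. inner_unit (\<phi> i) (\<phi> j) = (if i = j then 1 else 0)) \<and>
     (\<forall>g\<in>L2_unit. (\<lambda>N. LINT x|unit_lborel. (g x - (\<Sum>i<N. inner_unit g (\<phi> i) * \<phi> i x))\<^sup>2)
                     \<longlonglongrightarrow> 0)"

definition densities_unit :: "(real \<Rightarrow> real) set" where
  "densities_unit =
     {f \<in> L2_unit. (\<forall>x\<in>{0..1}. 0 \<le> f x) \<and> integrable unit_lborel f \<and> (LINT x|unit_lborel. f x) = 1}"

definition basis_coeffs :: "(nat \<Rightarrow> real \<Rightarrow> real) \<Rightarrow> (real \<Rightarrow> real) \<Rightarrow> nat \<Rightarrow> real" where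
  "basis_coeffs \<phi> f = (\<lambda>i. inner_unit (\<phi> i) f)"

(* P f is the probability under which the X l (l < n) are i.i.d. with density f; the sample is
   X 0, ..., X (n - 1). *)

definition iid_model :: "nat \<Rightarrow> ((real \<Rightarrow> real) \<Rightarrow> 'w measure) \<Rightarrow> (nat \<Rightarrow> 'w \<Rightarrow> real) \<Rightarrow> bool" where
  "iid_model n P X \<longleftrightarrow>
     (\<forall>f\<in>densities_unit.
        prob_space (P f) \<and>
        prob_space.indep_vars (P f) (\<lambda>_. unit_lborel) X {..<n} \<and>
        (\<forall>l<n. distributed (P f) unit_lborel (X l) (\<lambda>x. ennreal (f x))))"

definition obs :: "(nat \<Rightarrow> real \<Rightarrow> real) \<Rightarrow> nat \<Rightarrow> (nat \<Rightarrow> 'w \<Rightarrow> real) \<Rightarrow> 'w \<Rightarrow> nat \<Rightarrow> real" where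
  "obs \<phi> n X \<omega> = (\<lambda>i. (1 / real n) * (\<Sum>l<n. \<phi> i (X l \<omega>)))"

definition pi_tilde :: "real \<Rightarrow> real \<Rightarrow> nat \<Rightarrow> (nat \<Rightarrow> real) \<Rightarrow> nat \<Rightarrow> real" where
  "pi_tilde \<kappa> \<sigma> n y I =
     exp (- \<kappa> * real I) * exp ((l2norm (proj I y))\<^sup>2 / (2 * \<sigma>\<^sup>2)) /
     (\<Sum>J\<le>n. exp (- \<kappa> * real J) * exp ((l2norm (proj J y))\<^sup>2 / (2 * \<sigma>\<^sup>2)))"

(* The exponential moment is taken in ennreal, so that the bound includes its finiteness. *)

definition admissible_Z :: "real \<Rightarrow> nat \<Rightarrow> (nat \<Rightarrow> real) measure \<Rightarrow> bool" where
  "admissible_Z \<alpha> n Q \<longleftrightarrow>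
     prob_space Q \<and> sets Q = sets (PiM UNIV (\<lambda>_. borel)) \<and>
     (\<forall>i. integrable Q (\<lambda>z. z i) \<and> (LINT z|Q. z i) = 0) \<and>
     (\<forall>I\<le>n. (\<integral>\<^sup>+ z. ennreal (exp (\<alpha> * (l2norm (proj I z))\<^sup>2)) \<partial>Q) \<le> ennreal (exp (real I)))"

definition pi_tilde_within ::
  "real \<Rightarrow> (nat \<Rightarrow> real) measure \<Rightarrow> nat \<Rightarrow> (nat \<Rightarrow> real) \<Rightarrow> (nat \<Rightarrow> real) set \<Rightarrow> real" where
  "pi_tilde_within \<sigma> Q I y B =
     measure Q {z \<in> space Q. (\<lambda>i. proj I y i + \<sigma> * proj I z i) \<in> B}"

definition argmax_selector :: "real \<Rightarrow> real \<Rightarrow> nat \<Rightarrow> ((nat \<Rightarrow> real) \<Rightarrow> nat) \<Rightarrow> bool" where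
  "argmax_selector \<kappa> \<sigma> n Ihat \<longleftrightarrow>
     Ihat \<in> measurable (PiM UNIV (\<lambda>_. borel)) (count_space UNIV) \<and>
     (\<forall>y. is_arg_max (pi_tilde \<kappa> \<sigma> n y) (\<lambda>I. I \<le> n) (Ihat y))"

(* The two procedures: Averaged is the pair with a tilde, Selected the pair with a check. *)

datatype procedure = Averaged | Selected

primrec post_struct ::
  "procedure \<Rightarrow> real \<Rightarrow> real \<Rightarrow> nat \<Rightarrow> ((nat \<Rightarrow> real) \<Rightarrow> nat) \<Rightarrow> (nat \<Rightarrow> real) \<Rightarrow> nat \<Rightarrow> real" where
  "post_struct Averaged \<kappa> \<sigma> n Ihat y = pi_tilde \<kappa> \<sigma> n y"
| "post_struct Selected \<kappa> \<sigma> n Ihat y = (\<lambda>I. if I = Ihat y then 1 else 0)"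

primrec post_param ::
  "procedure \<Rightarrow> real \<Rightarrow> real \<Rightarrow> nat \<Rightarrow> (nat \<Rightarrow> real) measure \<Rightarrow> ((nat \<Rightarrow> real) \<Rightarrow> nat) \<Rightarrow>
     (nat \<Rightarrow> real) \<Rightarrow> (nat \<Rightarrow> real) set \<Rightarrow> real" where
  "post_param Averaged \<kappa> \<sigma> n Q Ihat y =
     (\<lambda>B. \<Sum>I\<le>n. pi_tilde_within \<sigma> Q I y B * pi_tilde \<kappa> \<sigma> n y I)"
| "post_param Selected \<kappa> \<sigma> n Q Ihat y = pi_tilde_within \<sigma> Q (Ihat y) y"

primrec estimator ::
  "procedure \<Rightarrow> real \<Rightarrow> real \<Rightarrow> nat \<Rightarrow> ((nat \<Rightarrow> real) \<Rightarrow> nat) \<Rightarrow> (nat \<Rightarrow> real) \<Rightarrow> nat \<Rightarrow> real" where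
  "estimator Averaged \<kappa> \<sigma> n Ihat y = (\<lambda>i. \<Sum>I\<le>n. proj I y i * pi_tilde \<kappa> \<sigma> n y I)"
| "estimator Selected \<kappa> \<sigma> n Ihat y = proj (Ihat y) y"

definition rhat2 :: "real \<Rightarrow> ((nat \<Rightarrow> real) \<Rightarrow> nat) \<Rightarrow> (nat \<Rightarrow> real) \<Rightarrow> real" where
  "rhat2 \<sigma> Ihat y = \<sigma>\<^sup>2 + \<sigma>\<^sup>2 * real (Ihat y)"

definition tail2 :: "nat \<Rightarrow> (nat \<Rightarrow> real) \<Rightarrow> real" where
  "tail2 I \<theta> = (\<Sum>i. (\<theta> (i + I))\<^sup>2)"

definition rate2 :: "real \<Rightarrow> nat \<Rightarrow> (nat \<Rightarrow> real) \<Rightarrow> real" where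
  "rate2 \<sigma> I \<theta> = tail2 I \<theta> + \<sigma>\<^sup>2 * real I"

definition oracle_rate2 :: "real \<Rightarrow> nat \<Rightarrow> (nat \<Rightarrow> real) \<Rightarrow> real" where
  "oracle_rate2 \<sigma> n \<theta> = Min ((\<lambda>I. rate2 \<sigma> I \<theta>) ` {..n})"

definition oracle_selector :: "real \<Rightarrow> real \<Rightarrow> nat \<Rightarrow> ((nat \<Rightarrow> real) \<Rightarrow> nat) \<Rightarrow> bool" where
  "oracle_selector \<tau>0 \<sigma> n Istar \<longleftrightarrow>
     (\<forall>\<theta>\<in>ell2. is_arg_min (\<lambda>I. tail2 I \<theta> + \<tau>0 * \<sigma>\<^sup>2 * real I) (\<lambda>I. I \<le> n) (Istar \<theta>))"

definition Theta_eb :: "real \<Rightarrow> ((nat \<Rightarrow> real) \<Rightarrow> nat) \<Rightarrow> real \<Rightarrow> (nat \<Rightarrow> real) set" where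
  "Theta_eb \<sigma> Istar t = {\<theta> \<in> ell2. tail2 (Istar \<theta>) \<theta> \<le> t * \<sigma>\<^sup>2 * (1 + real (Istar \<theta>))}"

end

(* By Hoeffding's inequality and a union bound, outside an event of probability at most
   2 n exp(-n sigma^2) every |Y_i - theta_i|^2 with i <= n is at most sigma^2/alpha; on this event
   all remaining bounds are deterministic.  Writing pi(I|Y) as proportional to exp(l(I)), both
   procedures have structure weights w(I) <= exp(l(I) - l(J)) for every J, and comparing I with the
   oracle J gives w(I) <= exp(-nu I - c2 M) as soon as r^2(I) >= c3 r^2 + M sigma^2.  Hence the
   mean of r^2(I) under w is at most c3 r^2 + const sigma^2, which controls the estimator by
   convexity; the exponential moment of Z then controls the posterior, and the radius is bounded
   because the selected index satisfies r^2(I) <= c3 r^2.  Comparing the selected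
   index with J = I_* shows that it is at least I_*, so on Theta_eb(t) the oracle rate is at most
   (t+1) times the squared radius. *)

theory Submission
  imports Defs
begin

section \<open>Structure weights and tails of sequences\<close>

lemma l2norm_proj_sq: "(l2norm (proj I x))\<^sup>2 = (\<Sum>i<I. (x i)\<^sup>2)"
proof -
  have "(\<Sum>i. (proj I x i)\<^sup>2) = (\<Sum>i<I. (proj I x i)\<^sup>2)"
    by (intro suminf_finite) (auto simp: proj_def)
  also have "\<dots> = (\<Sum>i<I. (x i)\<^sup>2)"
    by (intro sum.cong) (auto simp: proj_def)
  finally show ?thesis
    by (simp add: l2norm_def sum_nonneg)
qed

lemma tail2_split:
  assumes "\<theta> \<in> ell2" "I \<le> J"
  shows "tail2 I \<theta> = (\<Sum>i=I..<J. (\<theta> i)\<^sup>2) + tail2 J \<theta>"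
proof -
  have "summable (\<lambda>i. (\<theta> (i + I))\<^sup>2)"
    using assms by (simp add: ell2_def summable_iff_shift[where f = "\<lambda>i. (\<theta> i)\<^sup>2"])
  from suminf_split_initial_segment[OF this, of "J - I"] assms(2)
  have "tail2 I \<theta> = tail2 J \<theta> + (\<Sum>i<J - I. (\<theta> (i + I))\<^sup>2)"
    by (simp add: tail2_def add.assoc)
  also have "(\<Sum>i<J - I. (\<theta> (i + I))\<^sup>2) = (\<Sum>i=I..<J. (\<theta> i)\<^sup>2)"
    using sum.shift_bounds_nat_ivl[of "\<lambda>i. (\<theta> i)\<^sup>2" 0 I "J - I"] assms(2)
    by (simp add: atLeast0LessThan)
  finally show ?thesis by simp
qed

lemma tail2_nonneg: "\<theta> \<in> ell2 \<Longrightarrow> 0 \<le> tail2 I \<theta>"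
  unfolding tail2_def
  by (intro suminf_nonneg)
    (auto simp: ell2_def summable_iff_shift[where f = "\<lambda>i. (\<theta> i)\<^sup>2"])

lemma l2dist_commute: "l2dist x y = l2dist y x"
  by (simp add: l2dist_def l2norm_def power2_commute)

text \<open>Estimators and posterior draws vanish from position \<open>n\<close> on, so their error
  is a finite sum plus the tail of \<theta>. Summability of the differences is inherited from that
  tail; it is what makes the infinite sum split and the square root in \<open>l2norm\<close>
  cancel.\<close>

lemma l2dist_sq_finite_support:
  assumes "\<theta> \<in> ell2" "\<And>i. n \<le> i \<Longrightarrow> x i = 0"
  shows "(l2dist x \<theta>)\<^sup>2 = (\<Sum>i<n. (x i - \<theta> i)\<^sup>2) + tail2 n \<theta>"
proof -
  have "summable (\<lambda>i. (\<theta> (i + n))\<^sup>2)"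
    using assms by (simp add: ell2_def summable_iff_shift[where f = "\<lambda>i. (\<theta> i)\<^sup>2"])
  then have "summable (\<lambda>i. (x (i + n) - \<theta> (i + n))\<^sup>2)"
    using assms(2) by simp
  then have s: "summable (\<lambda>i. (x i - \<theta> i)\<^sup>2)"
    by (subst (asm) summable_iff_shift[where f = "\<lambda>i. (x i - \<theta> i)\<^sup>2"])
  have "(l2dist x \<theta>)\<^sup>2 = (\<Sum>i. (x i - \<theta> i)\<^sup>2)"
    using s by (simp add: l2dist_def l2norm_def suminf_nonneg)
  also have "\<dots> = (\<Sum>i<n. (x i - \<theta> i)\<^sup>2) + tail2 n \<theta>"
    using suminf_split_initial_segment[OF s, of n] assms(2) by (simp add: tail2_def)
  finally show ?thesis .
qed

text \<open>Jensen's inequality for the square: the difference of the two sides is the weighted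
  variance about the mean \<open>m\<close>, which is nonnegative.\<close>

lemma weighted_mean_sq_le:
  fixes w x :: "'a \<Rightarrow> real"
  assumes "finite A" "\<And>i. i \<in> A \<Longrightarrow> 0 \<le> w i" "sum w A = 1"
  shows "((\<Sum>i\<in>A. x i * w i) - c)\<^sup>2 \<le> (\<Sum>i\<in>A. w i * (x i - c)\<^sup>2)"
proof -
  define m where "m = (\<Sum>i\<in>A. x i * w i)"
  have "0 \<le> (\<Sum>i\<in>A. w i * (x i - m)\<^sup>2)"
    using assms by (intro sum_nonneg) auto
  also have "\<dots> = (\<Sum>i\<in>A. w i * (x i - c)\<^sup>2 - 2 * (m - c) * (x i * w i) + (m\<^sup>2 - c\<^sup>2) * w i)"
    by (intro sum.cong) (auto simp: power2_eq_square algebra_simps)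
  also have "\<dots> = (\<Sum>i\<in>A. w i * (x i - c)\<^sup>2) - 2 * (m - c) * m + (m\<^sup>2 - c\<^sup>2)"
    by (simp add: sum.distrib sum_subtractf assms(3) m_def flip: sum_distrib_left)
  also have "\<dots> = (\<Sum>i\<in>A. w i * (x i - c)\<^sup>2) - (m - c)\<^sup>2"
    by (simp add: power2_eq_square algebra_simps)
  finally show ?thesis by (simp add: m_def)
qed

lemma sum_exp_neg_le:
  assumes "0 < (\<nu>::real)"
  shows "(\<Sum>I\<le>n. exp (- \<nu> * real I)) \<le> exp \<nu> / (exp \<nu> - 1)"
proof -
  have e: "norm (exp (- \<nu>)) < 1" using assms by simp
  have "(\<Sum>I\<le>n. exp (- \<nu> * real I)) = (\<Sum>I\<le>n. exp (- \<nu>) ^ I)"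
    by (simp add: mult.commute flip: exp_of_nat_mult)
  also have "\<dots> \<le> (\<Sum>I. exp (- \<nu>) ^ I)"
    using e by (intro sum_le_suminf summable_geometric) auto
  also have "\<dots> = 1 / (1 - exp (- \<nu>))"
    using e by (rule suminf_geometric)
  also have "\<dots> = exp \<nu> / (exp \<nu> - 1)"
    using assms by (simp add: exp_minus field_simps)
  finally show ?thesis .
qed

text \<open>The logarithm of the unnormalised weight in \<open>pi_tilde\<close>. The normalising
  constant cancels in differences, so two structures are compared through differences of this
  function.\<close>

definition log_weight :: "real \<Rightarrow> real \<Rightarrow> (nat \<Rightarrow> real) \<Rightarrow> nat \<Rightarrow> real" where
  "log_weight \<kappa> \<sigma> y I = - \<kappa> * real I + (\<Sum>i<I. (y i)\<^sup>2) / (2 * \<sigma>\<^sup>2)"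

lemma pi_tilde_eq:
  "pi_tilde \<kappa> \<sigma> n y I = exp (log_weight \<kappa> \<sigma> y I) / (\<Sum>J\<le>n. exp (log_weight \<kappa> \<sigma> y J))"
  by (simp only: pi_tilde_def log_weight_def exp_add l2norm_proj_sq)

lemma sum_exp_log_weight_pos: "0 < (\<Sum>J\<le>n. exp (log_weight \<kappa> \<sigma> y J))"
  by (intro sum_pos) auto

lemma log_weight_argmax:
  assumes "argmax_selector \<kappa> \<sigma> n Ihat"
  shows "Ihat y \<le> n" "J \<le> n \<Longrightarrow> log_weight \<kappa> \<sigma> y J \<le> log_weight \<kappa> \<sigma> y (Ihat y)"
proof -
  have arg: "is_arg_max (pi_tilde \<kappa> \<sigma> n y) (\<lambda>I. I \<le> n) (Ihat y)"
    using assms by (simp add: argmax_selector_def)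
  then show "Ihat y \<le> n" by (simp add: is_arg_max_def)
  show "log_weight \<kappa> \<sigma> y J \<le> log_weight \<kappa> \<sigma> y (Ihat y)" if "J \<le> n"
  proof -
    have "pi_tilde \<kappa> \<sigma> n y J \<le> pi_tilde \<kappa> \<sigma> n y (Ihat y)"
      using arg that by (auto simp: is_arg_max_linorder)
    then show ?thesis
      using sum_exp_log_weight_pos[of \<kappa> \<sigma> y n] by (simp add: pi_tilde_eq divide_le_cancel)
  qed
qed

section \<open>Structure weights common to both procedures\<close>

lemma post_struct_nonneg: "0 \<le> post_struct proc \<kappa> \<sigma> n Ihat y I"
  by (cases proc) (auto simp: pi_tilde_eq intro!: divide_nonneg_nonneg sum_nonneg)

lemma sum_post_struct:
  assumes "argmax_selector \<kappa> \<sigma> n Ihat"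
  shows "(\<Sum>I\<le>n. post_struct proc \<kappa> \<sigma> n Ihat y I) = 1"
proof (cases proc)
  case Averaged
  then show ?thesis
    using sum_exp_log_weight_pos[of \<kappa> \<sigma> y n]
    by (simp add: pi_tilde_eq flip: sum_divide_distrib)
next
  case Selected
  then show ?thesis using log_weight_argmax(1)[OF assms, of y] by simp
qed

text \<open>For \<open>Averaged\<close>, keep only the term \<open>J\<close> of the normalising sum.
  For \<open>Selected\<close>, the weight is 0 away from the maximizer, and at the maximizer the
  exponent is nonnegative, so the right side is at least 1. All later bounds on weights go through
  this inequality, which is why one argument serves both procedures.\<close>

lemma post_struct_le:
  assumes "argmax_selector \<kappa> \<sigma> n Ihat" "I \<le> n" "J \<le> n"
  shows "post_struct proc \<kappa> \<sigma> n Ihat y I \<le> exp (log_weight \<kappa> \<sigma> y I - log_weight \<kappa> \<sigma> y J)"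
proof (cases proc)
  case Averaged
  have "exp (log_weight \<kappa> \<sigma> y J) \<le> (\<Sum>J\<le>n. exp (log_weight \<kappa> \<sigma> y J))"
    using assms(3) by (intro member_le_sum) auto
  then show ?thesis
    by (simp add: Averaged pi_tilde_eq exp_diff sum_exp_log_weight_pos divide_left_mono)
next
  case Selected
  then show ?thesis using log_weight_argmax(2)[OF assms(1,3), of y] by simp
qed

text \<open>For \<open>Selected\<close> the sum collapses to the single index \<open>Ihat y\<close>,
  which is at most \<open>n\<close>. Together with the analogous formula for the posterior, this
  makes both procedures mixtures over structures.\<close>

lemma estimator_eq:
  assumes "argmax_selector \<kappa> \<sigma> n Ihat"
  shows "estimator proc \<kappa> \<sigma> n Ihat y i = (\<Sum>I\<le>n. proj I y i * post_struct proc \<kappa> \<sigma> n Ihat y I)"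
proof (cases proc)
  case Selected
  then show ?thesis
    using log_weight_argmax(1)[OF assms, of y] by (simp add: if_distrib cong: if_cong)
qed simp

lemma post_param_eq:
  assumes "argmax_selector \<kappa> \<sigma> n Ihat"
  shows "post_param proc \<kappa> \<sigma> n Q Ihat y B =
    (\<Sum>I\<le>n. pi_tilde_within \<sigma> Q I y B * post_struct proc \<kappa> \<sigma> n Ihat y I)"
proof (cases proc)
  case Selected
  then show ?thesis
    using log_weight_argmax(1)[OF assms, of y] by (simp add: if_distrib cong: if_cong)
qed simp

section \<open>Oracle rate, total masses and the tail of the law of Z\<close>

lemma oracle_rate2_attained:
  obtains J where "J \<le> n" "rate2 \<sigma> J \<theta> = oracle_rate2 \<sigma> n \<theta>"
proof -
  have "oracle_rate2 \<sigma> n \<theta> \<in> (\<lambda>I. rate2 \<sigma> I \<theta>) ` {..n}"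
    unfolding oracle_rate2_def by (intro Min_in) auto
  then show ?thesis using that by auto
qed

lemma oracle_rate2_le: "I \<le> n \<Longrightarrow> oracle_rate2 \<sigma> n \<theta> \<le> rate2 \<sigma> I \<theta>"
  unfolding oracle_rate2_def by (intro Min_le) auto

lemma pi_tilde_within_le_1: "admissible_Z \<alpha> n Q \<Longrightarrow> pi_tilde_within \<sigma> Q I y B \<le> 1"
  by (simp add: pi_tilde_within_def admissible_Z_def prob_space.prob_le_1)

lemma post_param_le_1:
  assumes "argmax_selector \<kappa> \<sigma> n Ihat" "admissible_Z \<alpha> n Q"
  shows "post_param proc \<kappa> \<sigma> n Q Ihat y B \<le> 1"
proof -
  have "(\<Sum>I\<le>n. pi_tilde_within \<sigma> Q I y B * post_struct proc \<kappa> \<sigma> n Ihat y I)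
      \<le> (\<Sum>I\<le>n. 1 * post_struct proc \<kappa> \<sigma> n Ihat y I)"
    using pi_tilde_within_le_1[OF assms(2)] by (intro sum_mono mult_right_mono post_struct_nonneg)
  then show ?thesis
    by (simp add: post_param_eq[OF assms(1)] sum_post_struct[OF assms(1)])
qed

text \<open>Chernoff's bound with parameter \<alpha>, the one at which the exponential moment is
  controlled. Measurability is recorded because the posterior mass of a set is later bounded by
  enlarging it to this event.\<close>

lemma admissible_Z_norm_tail:
  assumes Q: "admissible_Z \<alpha> n Q" and "0 < \<alpha>" "I \<le> n"
  shows "measure Q {z \<in> space Q. s \<le> (\<Sum>i<I. (z i)\<^sup>2)} \<le> exp (real I - \<alpha> * s)"
    and "{z \<in> space Q. s \<le> (\<Sum>i<I. (z i)\<^sup>2)} \<in> sets Q"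
proof -
  interpret prob_space Q using Q by (simp add: admissible_Z_def)
  have sets: "sets Q = sets (PiM UNIV (\<lambda>_. borel))" using Q by (simp add: admissible_Z_def)
  have [measurable]: "(\<lambda>z. z i) \<in> borel_measurable Q" for i
    unfolding measurable_cong_sets[OF sets refl] by measurable
  show "{z \<in> space Q. s \<le> (\<Sum>i<I. (z i)\<^sup>2)} \<in> sets Q" by measurable
  have "emeasure Q {z \<in> space Q. (\<Sum>i<I. (z i)\<^sup>2) \<ge> s}
      \<le> ennreal (exp (- \<alpha> * s)) * (\<integral>\<^sup>+z\<in>space Q. exp (\<alpha> * (\<Sum>i<I. (z i)\<^sup>2)) \<partial>Q)"
    using assms(2) by (intro Chernoff_ineq_nn_integral_ge) auto
  also have "(\<integral>\<^sup>+z\<in>space Q. exp (\<alpha> * (\<Sum>i<I. (z i)\<^sup>2)) \<partial>Q)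
      = (\<integral>\<^sup>+z. exp (\<alpha> * (\<Sum>i<I. (z i)\<^sup>2)) \<partial>Q)"
    by (intro nn_integral_cong) auto
  also have "\<dots> \<le> ennreal (exp (real I))"
    using Q assms(3) by (simp add: admissible_Z_def l2norm_proj_sq)
  also have "ennreal (exp (- \<alpha> * s)) * ennreal (exp (real I)) = ennreal (exp (real I - \<alpha> * s))"
    by (simp add: exp_diff exp_minus divide_simps flip: ennreal_mult)
  finally show "measure Q {z \<in> space Q. s \<le> (\<Sum>i<I. (z i)\<^sup>2)} \<le> exp (real I - \<alpha> * s)"
    by (simp add: emeasure_eq_measure mult_left_mono)
qed

section \<open>Concentration of the empirical coefficients\<close>

lemma borel_measurable_basis:
  "orthonormal_basis_unit \<phi> \<Longrightarrow> \<phi> i \<in> borel_measurable unit_lborel"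
  by (auto simp: orthonormal_basis_unit_def L2_unit_def)

lemma L2_unit_integrable_mult:
  assumes "g \<in> L2_unit" "h \<in> L2_unit"
  shows "integrable unit_lborel (\<lambda>x. g x * h x)"
proof (rule Bochner_Integration.integrable_bound)
  have [measurable]: "g \<in> borel_measurable unit_lborel" "h \<in> borel_measurable unit_lborel"
    using assms by (auto simp: L2_unit_def)
  show "integrable unit_lborel (\<lambda>x. (g x)\<^sup>2 + (h x)\<^sup>2)"
    using assms by (auto simp: L2_unit_def)
  show "(\<lambda>x. g x * h x) \<in> borel_measurable unit_lborel" by measurable
  have "\<bar>g x * h x\<bar> \<le> (g x)\<^sup>2 + (h x)\<^sup>2" for x
    using sum_squares_bound[of "\<bar>g x\<bar>" "\<bar>h x\<bar>"]
      mult_nonneg_nonneg[OF abs_ge_zero[of "g x"] abs_ge_zero[of "h x"]]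
    unfolding abs_mult power2_abs by linarith
  then show "AE x in unit_lborel. norm (g x * h x) \<le> norm ((g x)\<^sup>2 + (h x)\<^sup>2)"
    by auto
qed

text \<open>Bessel's inequality: expanding the squared norm of the residual after \<open>N\<close>
  terms bounds every partial sum of squared coefficients by the squared norm of
  \<open>f\<close>.\<close>

lemma basis_coeffs_in_ell2:
  assumes basis: "orthonormal_basis_unit \<phi>" and f: "f \<in> L2_unit"
  shows "basis_coeffs \<phi> f \<in> ell2"
proof -
  define \<theta> where "\<theta> = basis_coeffs \<phi> f"
  have \<phi>: "\<phi> i \<in> L2_unit" and orth: "inner_unit (\<phi> i) (\<phi> j) = (if i = j then 1 else 0)" for i j
    using basis by (auto simp: orthonormal_basis_unit_def)
  have \<theta>: "inner_unit f (\<phi> i) = \<theta> i" for i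
    by (simp add: \<theta>_def basis_coeffs_def inner_unit_def mult.commute)
  note int [simp] = L2_unit_integrable_mult[OF f f] L2_unit_integrable_mult[OF f \<phi>]
    L2_unit_integrable_mult[OF \<phi> \<phi>]
  have "(\<Sum>i<N. (\<theta> i)\<^sup>2) \<le> inner_unit f f" for N
  proof -
    have "0 \<le> (LINT x|unit_lborel. (f x - (\<Sum>i<N. \<theta> i * \<phi> i x))\<^sup>2)"
      by simp
    also have "\<dots> = (LINT x|unit_lborel. f x * f x - (\<Sum>i<N. 2 * \<theta> i * (f x * \<phi> i x))
        + (\<Sum>i<N. \<Sum>j<N. \<theta> i * \<theta> j * (\<phi> i x * \<phi> j x)))"
      by (intro Bochner_Integration.integral_cong refl)
        (simp add: power2_eq_square algebra_simps sum_product sum_distrib_left sum_distrib_right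
          flip: sum.distrib)
    also have "\<dots> = inner_unit f f - (\<Sum>i<N. 2 * \<theta> i * inner_unit f (\<phi> i))
        + (\<Sum>i<N. \<Sum>j<N. \<theta> i * \<theta> j * inner_unit (\<phi> i) (\<phi> j))"
      by (simp add: inner_unit_def Bochner_Integration.integral_sum)
    also have "\<dots> = inner_unit f f - (\<Sum>i<N. (\<theta> i)\<^sup>2)"
      by (simp add: orth \<theta> power2_eq_square if_distrib mult.assoc flip: sum_distrib_left cong: if_cong)
    finally show ?thesis by simp
  qed
  then have "summable (\<lambda>i. (\<theta> i)\<^sup>2)"
    by (intro summableI_nonneg_bounded) auto
  then show ?thesis by (simp add: ell2_def \<theta>_def)
qed

text \<open>Hoeffding's inequality for \<open>n\<close> independent terms in an interval of length
  \<open>2 * c\<close>; the exponent \<open>2 * (n * s)^2 / (n * (2 * c)^2)\<close> simplifies to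
  the stated one.\<close>

lemma obs_coordinate_deviation:
  assumes basis: "orthonormal_basis_unit \<phi>"
    and bounded: "\<forall>x\<in>{0..1}. \<bar>\<phi> i x\<bar> \<le> c" and c: "0 < c"
    and n: "1 \<le> n" and model: "iid_model n P X" and f: "f \<in> densities_unit" and s: "0 \<le> s"
  shows "{\<omega> \<in> space (P f). s \<le> \<bar>obs \<phi> n X \<omega> i - basis_coeffs \<phi> f i\<bar>} \<in> sets (P f)"
    and "measure (P f) {\<omega> \<in> space (P f). s \<le> \<bar>obs \<phi> n X \<omega> i - basis_coeffs \<phi> f i\<bar>}
      \<le> 2 * exp (- (real n * s\<^sup>2 / (2 * c\<^sup>2)))"
proof -
  have indep: "prob_space.indep_vars (P f) (\<lambda>_. unit_lborel) X {..<n}"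
    and dist: "\<And>l. l < n \<Longrightarrow> distributed (P f) unit_lborel (X l) (\<lambda>x. ennreal (f x))"
    and prob: "prob_space (P f)"
    using model f by (auto simp: iid_model_def)
  interpret prob_space "P f" by (rule prob)
  have [measurable]: "\<phi> i \<in> borel_measurable unit_lborel"
    using basis by (rule borel_measurable_basis)
  have X [measurable]: "X l \<in> measurable (P f) unit_lborel" if "l < n" for l
    using dist[OF that] by (simp add: distributed_def)
  interpret Hoeffding_ineq "P f" "{..<n}" "\<lambda>l \<omega>. \<phi> i (X l \<omega>)" "\<lambda>_. - c" "\<lambda>_. c"
    "\<Sum>l<n. expectation (\<lambda>\<omega>. \<phi> i (X l \<omega>))"
  proof (unfold_locales, goal_cases)
    case 2
    show ?case by (rule indep_vars_compose2[OF indep]) measurable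
  next
    case (3 l)
    \<comment> \<open>The bound on the basis functions holds on the unit interval only, so the
      sample values must be located there first.\<close>
    have "X l \<omega> \<in> {0..1}" if "\<omega> \<in> space (P f)" for \<omega>
      using measurable_space[OF X that] 3 by (auto simp: space_restrict_space)
    then show ?case using bounded by (intro AE_I2) (force simp: abs_le_iff)
  qed auto
  have exp: "expectation (\<lambda>\<omega>. \<phi> i (X l \<omega>)) = basis_coeffs \<phi> f i" if "l < n" for l
    using distributed_integral[OF dist[OF that], of "\<phi> i"] f
    by (simp add: basis_coeffs_def inner_unit_def mult.commute densities_unit_def
        space_restrict_space)
  \<comment> \<open>Hoeffding's inequality concerns sums, the observations are averages; the
    threshold is multiplied by \<open>n\<close>.\<close>
  have eq: "{\<omega> \<in> space (P f). s \<le> \<bar>obs \<phi> n X \<omega> i - basis_coeffs \<phi> f i\<bar>} =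
    {\<omega> \<in> space (P f). real n * s \<le> \<bar>(\<Sum>l<n. \<phi> i (X l \<omega>)) - (\<Sum>l<n. expectation (\<lambda>\<omega>. \<phi> i (X l \<omega>)))\<bar>}"
  proof -
    have "(\<Sum>l<n. \<phi> i (X l \<omega>)) - (\<Sum>l<n. expectation (\<lambda>\<omega>. \<phi> i (X l \<omega>)))
        = real n * (obs \<phi> n X \<omega> i - basis_coeffs \<phi> f i)" for \<omega>
      using n by (simp add: exp obs_def right_diff_distrib)
    then show ?thesis using n by (simp add: abs_mult)
  qed
  show "{\<omega> \<in> space (P f). s \<le> \<bar>obs \<phi> n X \<omega> i - basis_coeffs \<phi> f i\<bar>} \<in> sets (P f)"
    unfolding obs_def by measurable
  have "measure (P f) {\<omega> \<in> space (P f). s \<le> \<bar>obs \<phi> n X \<omega> i - basis_coeffs \<phi> f i\<bar>}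
    \<le> 2 * exp (- 2 * (real n * s)\<^sup>2 / (\<Sum>l<n. (c - - c)\<^sup>2))"
    unfolding eq using n c s by (intro Hoeffding_ineq_abs_ge) auto
  also have "- 2 * (real n * s)\<^sup>2 / (\<Sum>l<n. (c - - c)\<^sup>2) = - (real n * s\<^sup>2 / (2 * c\<^sup>2))"
    using n c by (simp add: power2_eq_square field_simps)
  finally show "measure (P f) {\<omega> \<in> space (P f). s \<le> \<bar>obs \<phi> n X \<omega> i - basis_coeffs \<phi> f i\<bar>}
      \<le> 2 * exp (- (real n * s\<^sup>2 / (2 * c\<^sup>2)))" .
qed

text \<open>A union bound over the coordinates \<open>i < n\<close>, the only ones that a projection
  with \<open>I \<le> n\<close> reads. The number of coordinates enters the exponent as
  \<open>ln (real n)\<close>.\<close>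

lemma obs_concentration:
  assumes basis: "orthonormal_basis_unit \<phi>"
    and bounded: "\<forall>i. \<forall>x\<in>{0..1}. \<bar>\<phi> i x\<bar> \<le> c" and c: "0 < c"
    and \<alpha>: "0 < \<alpha>" "\<alpha> \<le> 1 / (2 * c\<^sup>2)" and \<sigma>: "0 < \<sigma>"
    and n: "1 \<le> n" and model: "iid_model n P X" and f: "f \<in> densities_unit"
  obtains G where "G \<in> sets (P f)"
    "emeasure (P f) (space (P f) - G) \<le> ennreal (2 * exp (- real n * \<sigma>\<^sup>2 + ln (real n)))"
    "\<And>\<omega> i. \<omega> \<in> G \<Longrightarrow> i < n \<Longrightarrow> (obs \<phi> n X \<omega> i - basis_coeffs \<phi> f i)\<^sup>2 \<le> \<sigma>\<^sup>2 / \<alpha>"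
proof -
  interpret prob_space "P f" using model f by (auto simp: iid_model_def)
  define s where "s = \<sigma> / sqrt \<alpha>"
  have s: "0 \<le> s" "s\<^sup>2 = \<sigma>\<^sup>2 / \<alpha>" using \<alpha> \<sigma> by (auto simp: s_def power_divide)
  define D where "D i = {\<omega> \<in> space (P f). s \<le> \<bar>obs \<phi> n X \<omega> i - basis_coeffs \<phi> f i\<bar>}" for i
  note dev = obs_coordinate_deviation[OF basis _ c n model f s(1), of i for i, folded D_def]
  have D: "D i \<in> sets (P f)" for i using dev(1) bounded by blast
  have "measure (P f) (D i) \<le> 2 * exp (- real n * \<sigma>\<^sup>2)" for i
  proof -
    \<comment> \<open>The threshold \<open>\<sigma> / sqrt \<alpha>\<close> is chosen for this:
      since \<open>2 * c\<^sup>2 * \<alpha> \<le> 1\<close>, the Hoeffding exponent is at least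
      \<open>n * \<sigma>\<^sup>2\<close>.\<close>
    have "1 * (real n * \<sigma>\<^sup>2) \<le> (1 / (2 * c\<^sup>2 * \<alpha>)) * (real n * \<sigma>\<^sup>2)"
      using \<alpha> c by (intro mult_right_mono) (auto simp: field_simps)
    also have "\<dots> = real n * s\<^sup>2 / (2 * c\<^sup>2)" by (simp add: s(2) field_simps)
    finally have "2 * exp (- (real n * s\<^sup>2 / (2 * c\<^sup>2))) \<le> 2 * exp (- real n * \<sigma>\<^sup>2)" by simp
    with dev(2)[of i] bounded show ?thesis by (meson order_trans)
  qed
  then have "(\<Sum>i<n. measure (P f) (D i)) \<le> (\<Sum>i<n. 2 * exp (- real n * \<sigma>\<^sup>2))"
    by (intro sum_mono) auto
  moreover have "measure (P f) (\<Union>i<n. D i) \<le> (\<Sum>i<n. measure (P f) (D i))"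
    using D by (intro finite_measure_subadditive_finite) auto
  moreover have "(\<Sum>i<n. 2 * exp (- real n * \<sigma>\<^sup>2)) = 2 * exp (- real n * \<sigma>\<^sup>2 + ln (real n))"
    using n by (subst exp_add) simp
  ultimately have m: "measure (P f) (\<Union>i<n. D i) \<le> 2 * exp (- real n * \<sigma>\<^sup>2 + ln (real n))"
    by linarith
  show ?thesis
  proof (rule that[of "space (P f) - (\<Union>i<n. D i)"])
    show "space (P f) - (\<Union>i<n. D i) \<in> sets (P f)" using D by auto
    have "space (P f) - (space (P f) - (\<Union>i<n. D i)) = (\<Union>i<n. D i)"
      by (auto simp: D_def)
    then show "emeasure (P f) (space (P f) - (space (P f) - (\<Union>i<n. D i)))
      \<le> ennreal (2 * exp (- real n * \<sigma>\<^sup>2 + ln (real n)))"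
      using m by (simp add: emeasure_eq_measure ennreal_leI)
    show "(obs \<phi> n X \<omega> i - basis_coeffs \<phi> f i)\<^sup>2 \<le> \<sigma>\<^sup>2 / \<alpha>"
      if "\<omega> \<in> space (P f) - (\<Union>i<n. D i)" "i < n" for \<omega> i
    proof -
      have "\<bar>obs \<phi> n X \<omega> i - basis_coeffs \<phi> f i\<bar> \<le> s"
        using that by (force simp: D_def)
      then have "\<bar>obs \<phi> n X \<omega> i - basis_coeffs \<phi> f i\<bar>\<^sup>2 \<le> s\<^sup>2" by (intro power_mono) auto
      then show ?thesis by (simp add: s(2))
    qed
  qed
qed

text \<open>A zero bound would make the first basis function vanish on the unit interval, against
  its unit norm.\<close>

lemma sup_bound_pos:
  assumes basis: "orthonormal_basis_unit \<phi>" and bounded: "\<forall>i. \<forall>x\<in>{0..1}. \<bar>\<phi> i x\<bar> \<le> c"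
  shows "0 < c"
proof -
  have "c \<noteq> 0"
  proof
    assume "c = 0"
    then have "\<phi> 0 x = 0" if "x \<in> {0..1}" for x using bounded that by auto
    then have "inner_unit (\<phi> 0) (\<phi> 0) = (LINT x|unit_lborel. 0)"
      unfolding inner_unit_def
      by (intro Bochner_Integration.integral_cong) (auto simp: space_restrict_space)
    then show False using basis by (auto simp: orthonormal_basis_unit_def)
  qed
  moreover have "0 \<le> c" using bounded[rule_format, of 0 0] by auto
  ultimately show ?thesis by simp
qed

text \<open>The integrand lies below the indicator of the complement of \<open>G\<close> plus the
  constant \<open>b\<close>. Monotonicity of the integral passes to this majorant, so measurability
  is checked for the majorant alone.\<close>

lemma (in prob_space) nn_integral_le_off_event:
  assumes G: "G \<in> sets M" "emeasure M (space M - G) \<le> ennreal p"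
    and g: "\<And>\<omega>. \<omega> \<in> space M \<Longrightarrow> g \<omega> \<le> 1" "\<And>\<omega>. \<omega> \<in> G \<Longrightarrow> g \<omega> \<le> b"
    and pb: "0 \<le> p" "0 \<le> b"
  shows "(\<integral>\<^sup>+\<omega>. ennreal (g \<omega>) \<partial>M) \<le> ennreal (p + b)"
proof -
  have "(\<integral>\<^sup>+\<omega>. ennreal (g \<omega>) \<partial>M) \<le> (\<integral>\<^sup>+\<omega>. indicator (space M - G) \<omega> + ennreal b \<partial>M)"
  proof (intro nn_integral_mono)
    fix \<omega> assume "\<omega> \<in> space M"
    then show "ennreal (g \<omega>) \<le> indicator (space M - G) \<omega> + ennreal b"
    proof (cases "\<omega> \<in> G")
      case True
      then show ?thesis using g(2) by (simp add: ennreal_leI)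
    next
      case False
      with \<open>\<omega> \<in> space M\<close> have "ennreal (g \<omega>) \<le> 1" using g(1) ennreal_leI by fastforce
      then show ?thesis
        using False \<open>\<omega> \<in> space M\<close> by (simp add: add_increasing2)
    qed
  qed
  also have "\<dots> = emeasure M (space M - G) + ennreal b"
    using G by (simp add: nn_integral_add emeasure_space_1)
  also have "\<dots> \<le> ennreal p + ennreal b" using G by (intro add_right_mono)
  finally show ?thesis using pb by (simp add: ennreal_plus)
qed

text \<open>Either \<open>b\<close> is at least 1 and the bound is trivial, or the event cannot
  occur on \<open>G\<close> and lies in its complement. In this form a deterministic bound on
  \<open>G\<close> becomes a tail bound: it suffices that the event forces \<open>M\<close> to be so
  small that the exponential term reaches 1.\<close>

lemma (in prob_space) emeasure_le_off_event:
  assumes G: "G \<in> sets M" "emeasure M (space M - G) \<le> ennreal p"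
    and b: "\<And>\<omega>. \<omega> \<in> G \<Longrightarrow> Q \<omega> \<Longrightarrow> 1 \<le> b"
    and pb: "0 \<le> p" "0 \<le> b"
  shows "emeasure M {\<omega> \<in> space M. Q \<omega>} \<le> ennreal (p + b)"
proof (cases "1 \<le> b")
  case True
  have "emeasure M {\<omega> \<in> space M. Q \<omega>} \<le> ennreal 1" using measure_le_1 by simp
  also have "\<dots> \<le> ennreal (p + b)" using True pb by (intro ennreal_leI) auto
  finally show ?thesis .
next
  case False
  then have "emeasure M {\<omega> \<in> space M. Q \<omega>} \<le> emeasure M (space M - G)"
    using b G by (intro emeasure_mono) auto
  also have "\<dots> \<le> ennreal (p + b)" using G pb by (meson ennreal_leI le_add_same_cancel1 order_trans)
  finally show ?thesis .
qed

section \<open>Bounds on the event of small deviations\<close>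

text \<open>Freezes one sample point of the good event: \<open>y\<close> is the observed sequence
  there, and \<open>deviation\<close> is all that is kept of its law. The only randomness left
  inside is that of Z.\<close>

locale concentrated_obs =
  fixes \<alpha> \<kappa> \<nu> \<sigma> :: real and n :: nat and y \<theta> :: "nat \<Rightarrow> real"
    and Ihat :: "(nat \<Rightarrow> real) \<Rightarrow> nat" and proc :: procedure
  assumes alpha: "0 < \<alpha>" "\<alpha> \<le> 1"
    and nu: "0 < \<nu>"
    and kappa: "\<kappa> > (32 * \<nu> + 10 + \<alpha>) / (4 * \<alpha>)"
    and sigma: "0 < \<sigma>"
    and ell2: "\<theta> \<in> ell2"
    and selector: "argmax_selector \<kappa> \<sigma> n Ihat"
    and deviation: "\<And>i. i < n \<Longrightarrow> (y i - \<theta> i)\<^sup>2 \<le> \<sigma>\<^sup>2 / \<alpha>"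
begin

abbreviation "w \<equiv> post_struct proc \<kappa> \<sigma> n Ihat y"
abbreviation "lw \<equiv> log_weight \<kappa> \<sigma> y"
abbreviation "R \<equiv> oracle_rate2 \<sigma> n \<theta>"
abbreviation "c2 \<equiv> \<alpha> / 16"
abbreviation "c3 \<equiv> 6 / \<alpha> + 4 * \<kappa>"
abbreviation "C\<nu> \<equiv> exp \<nu> / (exp \<nu> - 1)"

text \<open>The assumed lower bound on \<kappa> equals
  \<open>8 * \<nu> / \<alpha> + 5 / (2 * \<alpha>) + 1 / 4\<close>. Dropping the last term and using
  \<open>\<alpha> \<le> 1\<close> leaves a form linear in \<nu> and \<open>1 / \<alpha>\<close>,
  suited to the comparisons below.\<close>

lemma kappa_bounds: "1 \<le> 1 / \<alpha>" "8 * \<nu> + 5 / 2 * (1 / \<alpha>) \<le> \<kappa>"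
proof -
  show "1 \<le> 1 / \<alpha>" using alpha by simp
  have "8 * \<nu> \<le> 8 * \<nu> / \<alpha>" using alpha nu by (simp add: field_simps)
  also have "8 * \<nu> / \<alpha> + 5 / 2 * (1 / \<alpha>) + 1 / 4 = (32 * \<nu> + 10 + \<alpha>) / (4 * \<alpha>)"
    using alpha by (simp add: field_simps)
  then have "8 * \<nu> / \<alpha> = (32 * \<nu> + 10 + \<alpha>) / (4 * \<alpha>) - 5 / 2 * (1 / \<alpha>) - 1 / 4" by simp
  finally show "8 * \<nu> + 5 / 2 * (1 / \<alpha>) \<le> \<kappa>" using kappa by simp
qed

lemma c3_ge_1: "1 \<le> c3"
  using kappa_bounds nu by simp

lemma sum_deviation_le:
  assumes "J \<le> I" "I \<le> n"
  shows "(\<Sum>i=J..<I. (y i - \<theta> i)\<^sup>2) \<le> \<sigma>\<^sup>2 * (1 / \<alpha>) * (real I - real J)"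
proof -
  have "(\<Sum>i=J..<I. (y i - \<theta> i)\<^sup>2) \<le> (\<Sum>i=J..<I. \<sigma>\<^sup>2 / \<alpha>)"
    using assms deviation by (intro sum_mono) auto
  then show ?thesis using assms by (simp add: of_nat_diff mult.commute)
qed

section \<open>Comparison of the log-weights of two structures\<close>

lemma log_weight_diff:
  assumes "J \<le> I"
  shows "lw I - lw J = - \<kappa> * (real I - real J) + (\<Sum>i=J..<I. (y i)\<^sup>2) / (2 * \<sigma>\<^sup>2)"
proof -
  have "(\<Sum>i<I. (y i)\<^sup>2) = (\<Sum>i<J. (y i)\<^sup>2) + (\<Sum>i=J..<I. (y i)\<^sup>2)"
    using sum.atLeastLessThan_concat[of 0 J I "\<lambda>i. (y i)\<^sup>2"] assms by (simp add: atLeast0LessThan)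
  then show ?thesis by (simp add: log_weight_def algebra_simps add_divide_distrib)
qed

text \<open>Each coordinate added to \<open>J\<close> is charged \<kappa>, while noise can return at
  most \<open>1 / \<alpha>\<close> of it; beyond that only the signal contained in the added block
  helps. The split of \<open>(y i)\<^sup>2\<close> into signal and noise is
  \<open>(y i - 2 * \<theta> i)\<^sup>2 \<ge> 0\<close> rearranged.\<close>

lemma log_weight_increase_le:
  assumes "J \<le> I" "I \<le> n"
  shows "lw I - lw J \<le> - (\<kappa> - 1 / \<alpha>) * (real I - real J) + (tail2 J \<theta> - tail2 I \<theta>) / \<sigma>\<^sup>2"
proof -
  have "(y i)\<^sup>2 \<le> 2 * (\<theta> i)\<^sup>2 + 2 * (y i - \<theta> i)\<^sup>2" for i
    using zero_le_power2[of "y i - 2 * \<theta> i"] by (simp add: power2_eq_square algebra_simps)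
  then have "(\<Sum>i=J..<I. (y i)\<^sup>2) \<le> 2 * (\<Sum>i=J..<I. (\<theta> i)\<^sup>2) + 2 * (\<Sum>i=J..<I. (y i - \<theta> i)\<^sup>2)"
    by (simp add: sum_mono sum_distrib_left flip: sum.distrib)
  also have "\<dots> \<le> 2 * (tail2 J \<theta> - tail2 I \<theta>) + 2 * (\<sigma>\<^sup>2 * (1 / \<alpha>) * (real I - real J))"
    using sum_deviation_le[OF assms] tail2_split[OF ell2 assms(1)] by argo
  finally have "(\<Sum>i=J..<I. (y i)\<^sup>2) / (2 * \<sigma>\<^sup>2)
    \<le> (2 * (tail2 J \<theta> - tail2 I \<theta>) + 2 * (\<sigma>\<^sup>2 * (1 / \<alpha>) * (real I - real J))) / (2 * \<sigma>\<^sup>2)"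
    by (rule divide_right_mono) auto
  also have "\<dots> = (tail2 J \<theta> - tail2 I \<theta>) / \<sigma>\<^sup>2 + (1 / \<alpha>) * (real I - real J)"
    using sigma alpha by (simp add: field_simps)
  finally show ?thesis
    unfolding log_weight_diff[OF assms(1)] by (simp add: algebra_simps)
qed

text \<open>The weight \<open>2 / 3\<close> in the lower bound for \<open>(y i)\<^sup>2\<close> is the one for which comparing
  the selected index with \<open>I\<^sub>*\<close> yields exactly the threshold \<open>\<tau>bar = 3 * (\<kappa> + 1 / \<alpha>)\<close>.\<close>

lemma log_weight_decrease_le:
  assumes "I \<le> J" "J \<le> n"
  shows "lw I - lw J \<le> (\<kappa> + 1 / \<alpha>) * (real J - real I) - (tail2 I \<theta> - tail2 J \<theta>) / (3 * \<sigma>\<^sup>2)"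
proof -
  have "2 / 3 * (\<theta> i)\<^sup>2 - 2 * (y i - \<theta> i)\<^sup>2 \<le> (y i)\<^sup>2" for i
    using zero_le_power2[of "3 * y i - 2 * \<theta> i"] by (simp add: power2_eq_square algebra_simps)
  then have "2 / 3 * (\<Sum>i=I..<J. (\<theta> i)\<^sup>2) - 2 * (\<Sum>i=I..<J. (y i - \<theta> i)\<^sup>2) \<le> (\<Sum>i=I..<J. (y i)\<^sup>2)"
    unfolding sum_distrib_left sum_subtractf[symmetric] by (intro sum_mono)
  then have "2 / 3 * (tail2 I \<theta> - tail2 J \<theta>) - 2 * (\<sigma>\<^sup>2 * (1 / \<alpha>) * (real J - real I)) \<le> (\<Sum>i=I..<J. (y i)\<^sup>2)"
    using sum_deviation_le[OF assms] tail2_split[OF ell2 assms(1)] by argo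
  then have "(2 / 3 * (tail2 I \<theta> - tail2 J \<theta>) - 2 * (\<sigma>\<^sup>2 * (1 / \<alpha>) * (real J - real I))) / (2 * \<sigma>\<^sup>2)
      \<le> (\<Sum>i=I..<J. (y i)\<^sup>2) / (2 * \<sigma>\<^sup>2)"
    by (rule divide_right_mono) auto
  moreover have "(2 / 3 * (tail2 I \<theta> - tail2 J \<theta>) - 2 * (\<sigma>\<^sup>2 * (1 / \<alpha>) * (real J - real I))) / (2 * \<sigma>\<^sup>2)
      = (tail2 I \<theta> - tail2 J \<theta>) / (3 * \<sigma>\<^sup>2) - (1 / \<alpha>) * (real J - real I)"
    using sigma alpha by (simp add: field_simps)
  ultimately show ?thesis
    using log_weight_diff[OF assms(1)] by (simp add: algebra_simps)
qed

text \<open>All quantities are divided by \<open>\<sigma>\<^sup>2\<close>. A structure larger than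
  the oracle \<open>J\<close> loses at least \<open>\<kappa> - 1 / \<alpha>\<close> per extra
  coordinate, up to the signal gained; a smaller one saves at most
  \<open>\<kappa> + 1 / \<alpha>\<close> per coordinate and loses a third of the extra tail. In both
  cases the excess rate pays for the oracle terms and leaves a margin linear in \<open>I\<close> and
  \<open>M\<close>.\<close>

lemma log_weight_bad_structure:
  assumes I: "I \<le> n" and J: "J \<le> n" "rate2 \<sigma> J \<theta> = R" and M: "0 \<le> M"
    and bad: "c3 * R + M * \<sigma>\<^sup>2 \<le> rate2 \<sigma> I \<theta>"
  shows "lw I - lw J \<le> - \<nu> * real I - c2 * M"
proof -
  define tI tJ where "tI = tail2 I \<theta> / \<sigma>\<^sup>2" and "tJ = tail2 J \<theta> / \<sigma>\<^sup>2"
  define a c where "a = 1 / \<alpha>" and "c = c3"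
  note kb = kappa_bounds[folded a_def]
  \<comment> \<open>The first bound serves the case \<open>I < J\<close>, the second the case
    \<open>J \<le> I\<close>; the third absorbs \<open>tJ\<close> in both.\<close>
  have c: "3 * (\<kappa> + a) \<le> c" "\<kappa> - a \<le> c" "2 \<le> c"
    using kb nu by (auto simp: c_def a_def)
  have t: "0 \<le> tI" "0 \<le> tJ" "0 < \<sigma>\<^sup>2"
    using sigma by (auto simp: tI_def tJ_def tail2_nonneg[OF ell2])
  have rI: "rate2 \<sigma> I \<theta> = \<sigma>\<^sup>2 * (tI + real I)" and rJ: "R = \<sigma>\<^sup>2 * (tJ + real J)"
    using sigma by (auto simp: J(2)[symmetric] rate2_def tI_def tJ_def distrib_left)
  have "\<sigma>\<^sup>2 * (c * (tJ + real J) + M) \<le> \<sigma>\<^sup>2 * (tI + real I)"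
    using bad unfolding rI rJ c_def by (simp only: distrib_left mult_ac)
  then have b: "c * (tJ + real J) + M \<le> tI + real I"
    using t(3) by simp
  have c2M: "c2 * M \<le> M / 3" "c2 * M \<le> M"
    using mult_right_mono[of c2 "1/3" M] alpha M by simp_all
  show ?thesis
  proof (cases "J \<le> I")
    case True
    have "tI \<le> tJ"
      unfolding tI_def tJ_def tail2_split[OF ell2 True]
      by (intro divide_right_mono) (auto intro!: sum_nonneg)
    \<comment> \<open>After \<open>\<nu> * I\<close> is set aside, at least one unit of penalty per
      coordinate of \<open>I\<close> remains, and \<open>b\<close> turns that into the margin
      \<open>M\<close>.\<close>
    have "1 * real I \<le> (\<kappa> - a - \<nu>) * real I"
      using kb nu by (intro mult_right_mono) auto
    moreover have "2 * tJ \<le> c * tJ" "(\<kappa> - a) * real J \<le> c * real J"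
      using c t by (intro mult_right_mono; simp)+
    moreover have "lw I - lw J \<le> - (\<kappa> - a) * (real I - real J) + (tJ - tI)"
      using log_weight_increase_le[OF True I] by (simp add: a_def tI_def tJ_def diff_divide_distrib)
    ultimately show ?thesis
      using b \<open>tI \<le> tJ\<close> c2M t(1) by (simp add: algebra_simps)
  next
    case False
    have "lw I - lw J \<le> (\<kappa> + a) * (real J - real I) - (tI - tJ) / 3"
      using log_weight_decrease_le[of I J] False J sigma
      by (simp add: a_def tI_def tJ_def diff_divide_distrib)
    \<comment> \<open>The factor 3 compensates the third of the tail: \<open>b\<close> divided by 3
      must dominate \<open>(\<kappa> + a) * J\<close>.\<close>
    moreover have "1 * tJ \<le> c * tJ" "3 * (\<kappa> + a) * real J \<le> c * real J"
      using c t by (intro mult_right_mono; simp)+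
    moreover have "\<nu> * real I \<le> (\<kappa> + a - 1 / 3) * real I"
      using kb nu by (intro mult_right_mono) auto
    ultimately show ?thesis
      using b c2M by (simp add: algebra_simps diff_divide_distrib)
  qed
qed

section \<open>Total weight of structures with large rate, and the mean rate\<close>

lemma weight_bad_structure:
  assumes I: "I \<le> n" and M: "0 \<le> M" and bad: "c3 * R + M * \<sigma>\<^sup>2 \<le> rate2 \<sigma> I \<theta>"
  shows "w I \<le> exp (- \<nu> * real I) * exp (- c2 * M)"
proof -
  obtain J where J: "J \<le> n" "rate2 \<sigma> J \<theta> = R" by (rule oracle_rate2_attained)
  have "w I \<le> exp (lw I - lw J)"
    using selector I J(1) by (rule post_struct_le)
  also have "\<dots> \<le> exp (- \<nu> * real I - c2 * M)"
    using log_weight_bad_structure[OF I J M bad] by simp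
  finally show ?thesis by (simp flip: exp_add)
qed

lemma sum_weights_bad:
  assumes "0 \<le> M"
  shows "(\<Sum>I | I \<le> n \<and> c3 * R + M * \<sigma>\<^sup>2 \<le> rate2 \<sigma> I \<theta>. w I) \<le> C\<nu> * exp (- c2 * M)"
proof -
  have "(\<Sum>I | I \<le> n \<and> c3 * R + M * \<sigma>\<^sup>2 \<le> rate2 \<sigma> I \<theta>. w I)
      \<le> (\<Sum>I | I \<le> n \<and> c3 * R + M * \<sigma>\<^sup>2 \<le> rate2 \<sigma> I \<theta>. exp (- \<nu> * real I) * exp (- c2 * M))"
    using assms by (intro sum_mono weight_bad_structure) auto
  also have "\<dots> \<le> (\<Sum>I\<le>n. exp (- \<nu> * real I) * exp (- c2 * M))"
    by (intro sum_mono2) auto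
  also have "\<dots> = (\<Sum>I\<le>n. exp (- \<nu> * real I)) * exp (- c2 * M)"
    by (simp add: sum_distrib_right)
  also have "\<dots> \<le> C\<nu> * exp (- c2 * M)"
    using sum_exp_neg_le[OF nu] by (intro mult_right_mono) auto
  finally show ?thesis .
qed

text \<open>A structure contributes either at most \<open>c3 * R\<close> times its weight, or an
  excess whose weight decays exponentially in the excess itself. Since
  \<open>x * exp (- c2 * x) \<le> 1 / c2\<close>, the excess costs at most
  \<open>\<sigma>\<^sup>2 / c2\<close> times a term of the geometric series.\<close>

lemma mean_rate2_le: "(\<Sum>I\<le>n. w I * rate2 \<sigma> I \<theta>) \<le> c3 * R + \<sigma>\<^sup>2 * (C\<nu> / c2)"
proof -
  have summand: "w I * rate2 \<sigma> I \<theta> \<le> c3 * R * w I + \<sigma>\<^sup>2 / c2 * exp (- \<nu> * real I)" if "I \<le> n" for I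
  proof (cases "rate2 \<sigma> I \<theta> \<le> c3 * R")
    case True
    then have "w I * rate2 \<sigma> I \<theta> \<le> w I * (c3 * R)"
      by (intro mult_left_mono post_struct_nonneg)
    also have "\<dots> \<le> c3 * R * w I + \<sigma>\<^sup>2 / c2 * exp (- \<nu> * real I)"
      using alpha by simp
    finally show ?thesis .
  next
    case False
    \<comment> \<open>The level is the exact excess of this particular \<open>I\<close>, so the
      exponential weight bound applies with equality in its hypothesis.\<close>
    define M where "M = (rate2 \<sigma> I \<theta> - c3 * R) / \<sigma>\<^sup>2"
    have M: "0 \<le> M" "rate2 \<sigma> I \<theta> = c3 * R + M * \<sigma>\<^sup>2" using False sigma by (auto simp: M_def)
    have "M * c2 \<le> exp (c2 * M)"
      using exp_ge_add_one_self[of "c2 * M"] by (subst mult.commute) linarith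
    then have "M \<le> exp (c2 * M) / c2" using alpha by (subst pos_le_divide_eq) auto
    then have "M * exp (- c2 * M) \<le> exp (c2 * M) / c2 * exp (- c2 * M)"
      by (intro mult_right_mono) auto
    also have "\<dots> = 1 / c2" by (simp add: exp_minus)
    finally have e: "M * exp (- c2 * M) \<le> 1 / c2" .
    have "w I * M \<le> exp (- \<nu> * real I) * exp (- c2 * M) * M"
      using weight_bad_structure[OF that M(1)] M by (intro mult_right_mono) auto
    also have "\<dots> = exp (- \<nu> * real I) * (M * exp (- c2 * M))" by simp
    also have "\<dots> \<le> exp (- \<nu> * real I) * (1 / c2)" using e by (intro mult_left_mono) auto
    finally have "\<sigma>\<^sup>2 * (w I * M) \<le> \<sigma>\<^sup>2 * (exp (- \<nu> * real I) * (1 / c2))"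
      by (intro mult_left_mono) auto
    then show ?thesis unfolding M(2) by (simp add: algebra_simps)
  qed
  have "(\<Sum>I\<le>n. w I * rate2 \<sigma> I \<theta>) \<le> (\<Sum>I\<le>n. c3 * R * w I + \<sigma>\<^sup>2 / c2 * exp (- \<nu> * real I))"
    using summand by (intro sum_mono) auto
  also have "\<dots> = c3 * R + \<sigma>\<^sup>2 / c2 * (\<Sum>I\<le>n. exp (- \<nu> * real I))"
    using sum_post_struct[OF selector] by (simp only: sum.distrib mult_1_right flip: sum_distrib_left)
  also have "\<dots> \<le> c3 * R + \<sigma>\<^sup>2 / c2 * C\<nu>"
    using sum_exp_neg_le[OF nu] alpha by (intro add_left_mono mult_left_mono) auto
  finally show ?thesis by (simp only: divide_inverse mult_ac)
qed

section \<open>Risk of the estimator\<close>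

lemma sum_deviation_tail_le:
  assumes "I \<le> n"
  shows "(\<Sum>i<I. (y i - \<theta> i)\<^sup>2) + tail2 I \<theta> \<le> 1 / \<alpha> * rate2 \<sigma> I \<theta>"
proof -
  have "1 * tail2 I \<theta> \<le> 1 / \<alpha> * tail2 I \<theta>"
    using kappa_bounds(1) tail2_nonneg[OF ell2] by (intro mult_right_mono)
  then show ?thesis
    using sum_deviation_le[of 0 I] assms by (simp add: rate2_def atLeast0LessThan algebra_simps add_divide_distrib)
qed

text \<open>Jensen's inequality in each coordinate moves the square inside the average over
  structures. What remains is the weighted mean of the losses of the projections, each at most
  \<open>1 / \<alpha>\<close> times its rate.\<close>

lemma estimator_risk_le:
  "(l2dist (estimator proc \<kappa> \<sigma> n Ihat y) \<theta>)\<^sup>2 \<le> 1 / \<alpha> * (c3 * R) + \<sigma>\<^sup>2 * (1 / \<alpha> * (C\<nu> / c2))"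
proof -
  note w1 = sum_post_struct[OF selector, of proc y]
  have est: "estimator proc \<kappa> \<sigma> n Ihat y i = (\<Sum>I\<le>n. proj I y i * w I)" for i
    using selector by (rule estimator_eq)
  have proj: "(\<Sum>i<n. (proj I y i - \<theta> i)\<^sup>2) + tail2 n \<theta> \<le> 1 / \<alpha> * rate2 \<sigma> I \<theta>" if "I \<le> n" for I
  proof -
    have "(\<Sum>i<n. (proj I y i - \<theta> i)\<^sup>2)
        = (\<Sum>i<I. (proj I y i - \<theta> i)\<^sup>2) + (\<Sum>i=I..<n. (proj I y i - \<theta> i)\<^sup>2)"
      using sum.atLeastLessThan_concat[of 0 I n "\<lambda>i. (proj I y i - \<theta> i)\<^sup>2"] that
      by (simp add: atLeast0LessThan)
    also have "\<dots> = (\<Sum>i<I. (y i - \<theta> i)\<^sup>2) + (\<Sum>i=I..<n. (\<theta> i)\<^sup>2)"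
      by (intro arg_cong2[where f = "(+)"] sum.cong) (auto simp: proj_def)
    finally show ?thesis
      using sum_deviation_tail_le[OF that] tail2_split[OF ell2 that] by simp
  qed
  have "(l2dist (estimator proc \<kappa> \<sigma> n Ihat y) \<theta>)\<^sup>2
      = (\<Sum>i<n. ((\<Sum>I\<le>n. proj I y i * w I) - \<theta> i)\<^sup>2) + tail2 n \<theta>"
    unfolding est[symmetric]
    by (intro l2dist_sq_finite_support ell2) (auto simp: est proj_def intro!: sum.neutral)
  \<comment> \<open>The common tail beyond \<open>n\<close> is also written as a weighted sum, the
    weights having total 1, so that it can be joined to each projection loss.\<close>
  also have "\<dots> \<le> (\<Sum>i<n. \<Sum>I\<le>n. w I * (proj I y i - \<theta> i)\<^sup>2) + (\<Sum>I\<le>n. w I * tail2 n \<theta>)"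
    using w1 by (intro add_mono sum_mono weighted_mean_sq_le post_struct_nonneg)
      (auto simp flip: sum_distrib_right)
  also have "\<dots> = (\<Sum>I\<le>n. w I * ((\<Sum>i<n. (proj I y i - \<theta> i)\<^sup>2) + tail2 n \<theta>))"
    by (subst sum.swap) (simp add: sum_distrib_left distrib_left sum.distrib)
  also have "\<dots> \<le> (\<Sum>I\<le>n. w I * (1 / \<alpha> * rate2 \<sigma> I \<theta>))"
    using proj by (intro sum_mono mult_left_mono post_struct_nonneg) auto
  also have "\<dots> = 1 / \<alpha> * (\<Sum>I\<le>n. w I * rate2 \<sigma> I \<theta>)"
    by (simp add: sum_divide_distrib)
  also have "\<dots> \<le> 1 / \<alpha> * (c3 * R + \<sigma>\<^sup>2 * (C\<nu> / c2))"
    using alpha by (intro mult_left_mono mean_rate2_le) auto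
  finally show ?thesis by (simp add: distrib_left mult_ac)
qed

section \<open>The selected index and the size of the radius\<close>

lemma rate2_Ihat_less:
  assumes "0 < M"
  shows "rate2 \<sigma> (Ihat y) \<theta> < c3 * R + M * \<sigma>\<^sup>2"
proof (rule ccontr)
  assume "\<not> ?thesis"
  then have bad: "c3 * R + M * \<sigma>\<^sup>2 \<le> rate2 \<sigma> (Ihat y) \<theta>" by simp
  obtain J where J: "J \<le> n" "rate2 \<sigma> J \<theta> = R" by (rule oracle_rate2_attained)
  \<comment> \<open>The selected index cannot have a smaller log-weight than the oracle. As
    \<open>Ihat y\<close> may be 0, it is \<open>M > 0\<close> that makes the opposite bound
    strictly negative.\<close>
  have "0 \<le> lw (Ihat y) - lw J" using log_weight_argmax(2)[OF selector J(1)] by simp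
  also have "\<dots> \<le> - \<nu> * real (Ihat y) - c2 * M"
    using log_weight_argmax(1)[OF selector] J assms bad by (intro log_weight_bad_structure) auto
  finally have "0 \<le> - (\<nu> * real (Ihat y)) - c2 * M" by simp
  moreover have "0 \<le> \<nu> * real (Ihat y)" "0 < c2 * M" using nu alpha assms by auto
  ultimately show False by linarith
qed

text \<open>If the selected \<open>I\<close> were below \<open>J = I_*\<close>, minimality of
  \<open>J\<close> would make the tail between them at least
  \<open>\<tau> * \<sigma>\<^sup>2\<close> per coordinate, whereas selecting \<open>I\<close> allows
  at most \<open>3 * (\<kappa> + 1 / \<alpha>) * \<sigma>\<^sup>2\<close> per coordinate.\<close>

lemma Ihat_ge_oracle_selector:
  assumes tau: "\<tau> > 3 * (1 + \<kappa> * \<alpha>) / \<alpha>" and sel: "oracle_selector \<tau> \<sigma> n Istar"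
  shows "Istar \<theta> \<le> Ihat y"
proof (rule ccontr)
  define I J where "I = Ihat y" and "J = Istar \<theta>"
  assume "\<not> ?thesis"
  then have IJ: "I < J" by (simp add: I_def J_def)
  have arg: "is_arg_min (\<lambda>I. tail2 I \<theta> + \<tau> * \<sigma>\<^sup>2 * real I) (\<lambda>I. I \<le> n) J"
    using sel ell2 by (auto simp: oracle_selector_def J_def)
  then have J: "J \<le> n" by (simp add: is_arg_min_def)
  have "tail2 J \<theta> + \<tau> * \<sigma>\<^sup>2 * real J \<le> tail2 I \<theta> + \<tau> * \<sigma>\<^sup>2 * real I"
    using arg IJ J by (auto simp: is_arg_min_linorder)
  then have "\<tau> * \<sigma>\<^sup>2 * (real J - real I) / (3 * \<sigma>\<^sup>2) \<le> (tail2 I \<theta> - tail2 J \<theta>) / (3 * \<sigma>\<^sup>2)"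
    by (intro divide_right_mono) (auto simp: algebra_simps)
  also have "\<dots> \<le> (\<kappa> + 1 / \<alpha>) * (real J - real I)"
    using log_weight_decrease_le[of I J] log_weight_argmax(2)[OF selector J, of y] IJ J
    by (simp add: I_def)
  also have "\<tau> * \<sigma>\<^sup>2 * (real J - real I) / (3 * \<sigma>\<^sup>2) = \<tau> * (real J - real I) / 3"
    using sigma by simp
  also have "\<kappa> + 1 / \<alpha> = 3 * (1 + \<kappa> * \<alpha>) / \<alpha> / 3"
    using alpha by (simp add: field_simps)
  finally have "\<tau> * (real J - real I) \<le> (3 * (1 + \<kappa> * \<alpha>) / \<alpha>) * (real J - real I)"
    by simp
  moreover have "(3 * (1 + \<kappa> * \<alpha>) / \<alpha>) * (real J - real I) < \<tau> * (real J - real I)"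
    using tau IJ by (intro mult_strict_right_mono) auto
  ultimately show False by linarith
qed

lemma risk_le_rhat2:
  assumes tau: "\<tau> > 3 * (1 + \<kappa> * \<alpha>) / \<alpha>" and sel: "oracle_selector \<tau> \<sigma> n Istar"
    and eb: "\<theta> \<in> Theta_eb \<sigma> Istar t" and t: "0 \<le> t"
  shows "(l2dist (estimator proc \<kappa> \<sigma> n Ihat y) \<theta>)\<^sup>2
    \<le> (t + 1) * (c3 / \<alpha> + C\<nu> / c2 / \<alpha>) * rhat2 \<sigma> Ihat y"
proof -
  define r where "r = rhat2 \<sigma> Ihat y"
  have r: "\<sigma>\<^sup>2 \<le> r" by (simp add: r_def rhat2_def)
  have "Istar \<theta> \<le> n"
    using sel ell2 by (auto simp: oracle_selector_def is_arg_min_def)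
  then have "R \<le> rate2 \<sigma> (Istar \<theta>) \<theta>" by (rule oracle_rate2_le)
  also have "\<dots> \<le> t * \<sigma>\<^sup>2 * (1 + real (Istar \<theta>)) + \<sigma>\<^sup>2 * real (Istar \<theta>)"
    using eb by (simp add: Theta_eb_def rate2_def)
  also have "\<dots> \<le> (t + 1) * (\<sigma>\<^sup>2 * (1 + real (Istar \<theta>)))" by (simp add: algebra_simps)
  also have "\<dots> \<le> (t + 1) * r"
    using Ihat_ge_oracle_selector[OF tau sel] t
    by (intro mult_left_mono) (auto simp: r_def rhat2_def distrib_left intro!: mult_left_mono)
  finally have "c3 / \<alpha> * R \<le> c3 / \<alpha> * ((t + 1) * r)"
    using c3_ge_1 alpha by (intro mult_left_mono) auto
  moreover have "\<sigma>\<^sup>2 \<le> (t + 1) * r"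
    using mult_mono[of 1 "t + 1" "\<sigma>\<^sup>2" r] r t by simp
  then have "C\<nu> / c2 / \<alpha> * \<sigma>\<^sup>2 \<le> C\<nu> / c2 / \<alpha> * ((t + 1) * r)"
    using nu alpha by (intro mult_left_mono) auto
  ultimately have "c3 / \<alpha> * R + C\<nu> / c2 / \<alpha> * \<sigma>\<^sup>2 \<le> (t + 1) * (c3 / \<alpha> + C\<nu> / c2 / \<alpha>) * r"
    by (simp add: distrib_left distrib_right mult_ac)
  moreover have "1 / \<alpha> * (c3 * R) + \<sigma>\<^sup>2 * (1 / \<alpha> * (C\<nu> / c2)) = c3 / \<alpha> * R + C\<nu> / c2 / \<alpha> * \<sigma>\<^sup>2"
    by (simp add: mult_ac)
  ultimately show ?thesis
    using estimator_risk_le unfolding r_def[symmetric] by linarith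
qed

section \<open>Spread of the posterior around the truth\<close>

lemma posterior_draw_dist_le:
  assumes "I \<le> n"
  shows "(l2dist \<theta> (\<lambda>i. proj I y i + \<sigma> * proj I z i))\<^sup>2
    \<le> 2 / \<alpha> * rate2 \<sigma> I \<theta> + 2 * \<sigma>\<^sup>2 * (\<Sum>i<I. (z i)\<^sup>2)"
proof -
  have "(l2dist \<theta> (\<lambda>i. proj I y i + \<sigma> * proj I z i))\<^sup>2
      = (\<Sum>i<I. (proj I y i + \<sigma> * proj I z i - \<theta> i)\<^sup>2) + tail2 I \<theta>"
    by (subst l2dist_commute, intro l2dist_sq_finite_support ell2) (simp add: proj_def)
  also have "(\<Sum>i<I. (proj I y i + \<sigma> * proj I z i - \<theta> i)\<^sup>2)
      \<le> (\<Sum>i<I. 2 * (y i - \<theta> i)\<^sup>2 + 2 * \<sigma>\<^sup>2 * (z i)\<^sup>2)"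
  proof (intro sum_mono)
    fix i assume "i \<in> {..<I}"
    then show "(proj I y i + \<sigma> * proj I z i - \<theta> i)\<^sup>2 \<le> 2 * (y i - \<theta> i)\<^sup>2 + 2 * \<sigma>\<^sup>2 * (z i)\<^sup>2"
      using zero_le_power2[of "y i - \<theta> i - \<sigma> * z i"]
      by (simp add: proj_def power2_eq_square algebra_simps)
  qed
  also have "\<dots> = 2 * (\<Sum>i<I. (y i - \<theta> i)\<^sup>2) + 2 * \<sigma>\<^sup>2 * (\<Sum>i<I. (z i)\<^sup>2)"
    by (simp add: sum.distrib sum_distrib_left)
  finally show ?thesis
    using sum_deviation_tail_le[OF assms] tail2_nonneg[OF ell2, of I] by simp
qed

text \<open>For a structure of moderate rate, a draw can be far from \<theta> only if the projected
  Z has squared norm at least \<open>s\<close>; the Chernoff bound applies to that event.\<close>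

lemma pi_tilde_within_good:
  assumes Q: "admissible_Z \<alpha> n Q" and I: "I \<le> n"
    and good: "rate2 \<sigma> I \<theta> < c3 * R + M * \<alpha> / 8 * \<sigma>\<^sup>2"
  shows "pi_tilde_within \<sigma> Q I y
      {\<theta>' \<in> ell2. (l2dist \<theta> \<theta>')\<^sup>2 \<ge> 4 * c3 / \<alpha> * R + M * \<sigma>\<^sup>2} \<le> exp (- (\<alpha> / 4) * M)"
proof -
  interpret Q: prob_space Q using Q by (simp add: admissible_Z_def)
  define s where "s = (4 * c3 / \<alpha> * R + M * \<sigma>\<^sup>2 - 2 / \<alpha> * rate2 \<sigma> I \<theta>) / (2 * \<sigma>\<^sup>2)"
  have "pi_tilde_within \<sigma> Q I y {\<theta>' \<in> ell2. (l2dist \<theta> \<theta>')\<^sup>2 \<ge> 4 * c3 / \<alpha> * R + M * \<sigma>\<^sup>2}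
      \<le> measure Q {z \<in> space Q. s \<le> (\<Sum>i<I. (z i)\<^sup>2)}"
    unfolding pi_tilde_within_def
  proof (intro Q.finite_measure_mono admissible_Z_norm_tail(2)[OF Q alpha(1) I] subsetI)
    fix z assume "z \<in> {z \<in> space Q. (\<lambda>i. proj I y i + \<sigma> * proj I z i) \<in>
      {\<theta>' \<in> ell2. (l2dist \<theta> \<theta>')\<^sup>2 \<ge> 4 * c3 / \<alpha> * R + M * \<sigma>\<^sup>2}}"
    then have z: "z \<in> space Q"
      and "4 * c3 / \<alpha> * R + M * \<sigma>\<^sup>2 \<le> 2 / \<alpha> * rate2 \<sigma> I \<theta> + 2 * \<sigma>\<^sup>2 * (\<Sum>i<I. (z i)\<^sup>2)"
      using posterior_draw_dist_le[OF I, of z] by auto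
    then have "4 * c3 / \<alpha> * R + M * \<sigma>\<^sup>2 - 2 / \<alpha> * rate2 \<sigma> I \<theta> \<le> (\<Sum>i<I. (z i)\<^sup>2) * (2 * \<sigma>\<^sup>2)"
      by (simp add: mult_ac)
    then have "s \<le> (\<Sum>i<I. (z i)\<^sup>2)"
      using sigma unfolding s_def by (subst pos_divide_le_eq) auto
    with z show "z \<in> {z \<in> space Q. s \<le> (\<Sum>i<I. (z i)\<^sup>2)}" by simp
  qed
  also have "\<dots> \<le> exp (real I - \<alpha> * s)"
    using Q alpha(1) I by (rule admissible_Z_norm_tail(1))
  also have "real I - \<alpha> * s \<le> - (\<alpha> / 4) * M"
  \<comment> \<open>Here \<open>4 * c3 / \<alpha>\<close> is explained: in
    \<open>\<sigma>\<^sup>2 * \<alpha> * s\<close> it becomes \<open>2 * c3 * R\<close>, one copy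
    for the rate in the distance bound and one for the dimension \<open>I\<close>. The two excesses
    of \<open>\<alpha> * M / 8\<close> leave \<open>\<alpha> * M / 4\<close> out of
    \<open>\<alpha> * M / 2\<close>.\<close>
  proof -
    have "\<sigma>\<^sup>2 * (\<alpha> * s) = 2 * (c3 * R) + \<alpha> * M * \<sigma>\<^sup>2 / 2 - rate2 \<sigma> I \<theta>"
      using sigma alpha by (simp add: s_def field_simps)
    moreover have "\<sigma>\<^sup>2 * real I \<le> rate2 \<sigma> I \<theta>"
      using tail2_nonneg[OF ell2] by (simp add: rate2_def)
    ultimately have "\<sigma>\<^sup>2 * (real I - \<alpha> * s) \<le> \<sigma>\<^sup>2 * (- (\<alpha> / 4) * M)"
      using good by (simp add: right_diff_distrib) (simp add: algebra_simps)
    then show ?thesis using sigma by (subst (asm) mult_le_cancel_left_pos) auto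
  qed
  finally show ?thesis by simp
qed

text \<open>Structures are split at excess level \<open>M * \<alpha> / 8\<close>. Those above it
  have small total weight; for those below it the posterior within the structure is
  concentrated.\<close>

lemma post_param_le:
  assumes Q: "admissible_Z \<alpha> n Q" and M: "0 \<le> M"
  shows "post_param proc \<kappa> \<sigma> n Q Ihat y
      {\<theta>' \<in> ell2. (l2dist \<theta> \<theta>')\<^sup>2 \<ge> 4 * c3 / \<alpha> * R + M * \<sigma>\<^sup>2}
    \<le> (C\<nu> + 1) * exp (- (c2 * \<alpha> / 8) * M)"
proof -
  define B where "B = {\<theta>' \<in> ell2. (l2dist \<theta> \<theta>')\<^sup>2 \<ge> 4 * c3 / \<alpha> * R + M * \<sigma>\<^sup>2}"
  define bad where "bad I \<longleftrightarrow> c3 * R + M * \<alpha> / 8 * \<sigma>\<^sup>2 \<le> rate2 \<sigma> I \<theta>" for I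
  have "pi_tilde_within \<sigma> Q I y B * w I \<le> (if bad I then w I else 0) + w I * exp (- (\<alpha> / 4) * M)"
    if "I \<le> n" for I
  proof (cases "bad I")
    case True
    have "pi_tilde_within \<sigma> Q I y B * w I \<le> 1 * w I"
      using pi_tilde_within_le_1[OF Q] by (intro mult_right_mono post_struct_nonneg)
    then show ?thesis
      using True post_struct_nonneg[of proc \<kappa> \<sigma> n Ihat y I] by (simp add: add_increasing2)
  next
    case False
    then have "pi_tilde_within \<sigma> Q I y B * w I \<le> exp (- (\<alpha> / 4) * M) * w I"
      unfolding B_def
      by (intro mult_right_mono post_struct_nonneg pi_tilde_within_good[OF Q that])
        (simp add: bad_def)
    then show ?thesis using False by (simp add: mult.commute)
  qed
  then have "(\<Sum>I\<le>n. pi_tilde_within \<sigma> Q I y B * w I)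
      \<le> (\<Sum>I\<le>n. (if bad I then w I else 0) + w I * exp (- (\<alpha> / 4) * M))"
    by (intro sum_mono) auto
  also have "\<dots> = (\<Sum>I | I \<le> n \<and> bad I. w I) + exp (- (\<alpha> / 4) * M)"
    using sum_post_struct[OF selector, of proc y]
    by (simp add: sum.distrib sum.If_cases Collect_conj_eq atMost_def flip: sum_distrib_right)
  also have "(\<Sum>I | I \<le> n \<and> bad I. w I) \<le> C\<nu> * exp (- c2 * (M * \<alpha> / 8))"
    unfolding bad_def using sum_weights_bad[of "M * \<alpha> / 8"] M alpha by simp
  \<comment> \<open>Both contributions are brought to the slower of the two exponential
    rates.\<close>
  also have "exp (- (\<alpha> / 4) * M) \<le> exp (- (c2 * \<alpha> / 8) * M)"
    proof -
    have "0 \<le> \<alpha> * M" using M alpha by simp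
    moreover from this have "\<alpha> * (\<alpha> * M) \<le> 1 * (\<alpha> * M)"
      using alpha by (intro mult_right_mono) auto
    ultimately have "(c2 * \<alpha> / 8) * M \<le> (\<alpha> / 4) * M" by argo
    then show ?thesis by simp
  qed
  finally show ?thesis
    unfolding B_def[symmetric] post_param_eq[OF selector]
    by (simp add: distrib_right mult_ac)
qed

end

section \<open>Oracle rates and coverage\<close>

theorem theorem11p1:
  fixes \<phi> :: "nat \<Rightarrow> real \<Rightarrow> real"
    and c\<^sub>\<phi> \<alpha> \<nu> \<kappa> \<delta> \<tau>bar \<tau>0 c2 c3 C\<^sub>\<nu> :: real
    and PZ :: "nat \<Rightarrow> (nat \<Rightarrow> real) measure"
  assumes basis: "orthonormal_basis_unit \<phi>"
    and bounded: "\<forall>i. \<forall>x\<in>{0..1}. \<bar>\<phi> i x\<bar> \<le> c\<^sub>\<phi>"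
    and alpha: "\<alpha> = min 1 (1 / (2 * c\<^sub>\<phi>\<^sup>2))"
    and nu: "\<nu> > 0"
    and kappa: "\<kappa> > (32 * \<nu> + 10 + \<alpha>) / (4 * \<alpha>)"
    and delta: "0 < \<delta>" "\<delta> < 1"
    and taubar: "\<tau>bar = 3 * (1 + \<kappa> * \<alpha>) / \<alpha>"
    and tau0: "\<tau>0 > (1 + \<delta>) / (1 - \<delta>) * \<tau>bar"
    and c2: "c2 = \<alpha> / 16"
    and c3: "c3 = 6 / \<alpha> + 4 * \<kappa>"
    and Cnu: "C\<^sub>\<nu> = exp \<nu> / (exp \<nu> - 1)"
    and Z: "\<forall>n\<ge>1. admissible_Z \<alpha> n (PZ n)"
  shows "\<exists>M0 M1 M2 M3 H0 H1 H2 H3 m0 m1 m2 m3 :: real.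
    M0 > 0 \<and> M1 > 0 \<and> M2 > 0 \<and> M3 > 0 \<and>
    H0 > 0 \<and> H1 > 0 \<and> H2 > 0 \<and> H3 > 0 \<and>
    m0 > 0 \<and> m1 > 0 \<and> m2 > 0 \<and> m3 > 0 \<and>
    (\<forall>(n :: nat) (\<sigma> :: real) (P :: (real \<Rightarrow> real) \<Rightarrow> 'w measure) (X :: nat \<Rightarrow> 'w \<Rightarrow> real)
       (Ihat :: (nat \<Rightarrow> real) \<Rightarrow> nat) (Istar :: (nat \<Rightarrow> real) \<Rightarrow> nat) (proc :: procedure)
       (M :: real) (t :: real).
      n \<ge> 1 \<longrightarrow> 0 < \<sigma> \<longrightarrow> \<sigma> \<le> 1 \<longrightarrow> iid_model n P X \<longrightarrow>
      argmax_selector \<kappa> \<sigma> n Ihat \<longrightarrow> oracle_selector \<tau>0 \<sigma> n Istar \<longrightarrow> M \<ge> 0 \<longrightarrow> t \<ge> 0 \<longrightarrow>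
      (SUP f\<in>densities_unit.
         \<integral>\<^sup>+ \<omega>. ennreal (post_param proc \<kappa> \<sigma> n (PZ n) Ihat (obs \<phi> n X \<omega>)
           {\<theta>' \<in> ell2. (l2dist (basis_coeffs \<phi> f) \<theta>')\<^sup>2
              \<ge> M0 * oracle_rate2 \<sigma> n (basis_coeffs \<phi> f) + M * \<sigma>\<^sup>2}) \<partial>P f)
        \<le> ennreal (2 * exp (- real n * \<sigma>\<^sup>2 + ln (real n)) + H0 * exp (- m0 * M)) \<and>
      (SUP f\<in>densities_unit.
         emeasure (P f) {\<omega> \<in> space (P f).
           (l2dist (estimator proc \<kappa> \<sigma> n Ihat (obs \<phi> n X \<omega>)) (basis_coeffs \<phi> f))\<^sup>2
              \<ge> M1 * oracle_rate2 \<sigma> n (basis_coeffs \<phi> f) + M * \<sigma>\<^sup>2})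
        \<le> ennreal (2 * exp (- real n * \<sigma>\<^sup>2 + ln (real n)) + H1 * exp (- m1 * M)) \<and>
      (SUP f\<in>densities_unit.
         \<integral>\<^sup>+ \<omega>. ennreal (\<Sum>I | I \<le> n \<and> rate2 \<sigma> I (basis_coeffs \<phi> f)
              \<ge> c3 * oracle_rate2 \<sigma> n (basis_coeffs \<phi> f) + M * \<sigma>\<^sup>2.
           post_struct proc \<kappa> \<sigma> n Ihat (obs \<phi> n X \<omega>) I) \<partial>P f)
        \<le> ennreal (2 * exp (- real n * \<sigma>\<^sup>2 + ln (real n)) + C\<^sub>\<nu> * exp (- c2 * M)) \<and>
      (SUP f\<in>densities_unit.
         emeasure (P f) {\<omega> \<in> space (P f).
           rhat2 \<sigma> Ihat (obs \<phi> n X \<omega>)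
              \<ge> M3 * oracle_rate2 \<sigma> n (basis_coeffs \<phi> f) + (M + 1) * \<sigma>\<^sup>2})
        \<le> ennreal (2 * exp (- real n * \<sigma>\<^sup>2 + ln (real n)) + H3 * exp (- m3 * M)) \<and>
      (SUP f\<in>{f \<in> densities_unit. basis_coeffs \<phi> f \<in> Theta_eb \<sigma> Istar t}.
         emeasure (P f) {\<omega> \<in> space (P f).
           basis_coeffs \<phi> f \<notin> l2ball (estimator proc \<kappa> \<sigma> n Ihat (obs \<phi> n X \<omega>))
              (sqrt ((t + 1) * M2 * rhat2 \<sigma> Ihat (obs \<phi> n X \<omega>) + (t + 2) * M * \<sigma>\<^sup>2))})
        \<le> ennreal (2 * exp (- real n * \<sigma>\<^sup>2 + ln (real n)) + H2 * exp (- m2 * M)))"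
proof -
  have c: "0 < c\<^sub>\<phi>" using basis bounded by (rule sup_bound_pos)
  then have \<alpha>: "0 < \<alpha>" "\<alpha> \<le> 1" "\<alpha> \<le> 1 / (2 * c\<^sub>\<phi>\<^sup>2)" by (auto simp: alpha)
  have "0 \<le> \<kappa>"
  proof -
    have "0 \<le> (32 * \<nu> + 10 + \<alpha>) / (4 * \<alpha>)" using nu \<alpha> by (intro divide_nonneg_pos) auto
    then show ?thesis using kappa by simp
  qed
  \<comment> \<open>The factor \<open>(1 + \<delta>) / (1 - \<delta>)\<close> is at least 1, so
    \<open>\<tau>0\<close> exceeds the threshold needed to compare the selected index with
    \<open>I_*\<close>.\<close>
  have tau: "\<tau>0 > 3 * (1 + \<kappa> * \<alpha>) / \<alpha>"
  proof -
    have "0 \<le> 3 * (1 + \<kappa> * \<alpha>) / \<alpha>" using \<open>0 \<le> \<kappa>\<close> \<alpha> by simp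
    then have "1 * (3 * (1 + \<kappa> * \<alpha>) / \<alpha>) \<le> (1 + \<delta>) / (1 - \<delta>) * \<tau>bar"
      unfolding taubar using delta by (intro mult_right_mono) auto
    then show ?thesis using tau0 by simp
  qed
  have pos: "0 < c3" "0 < c2" "0 < C\<^sub>\<nu>"
    using \<alpha> \<open>0 \<le> \<kappa>\<close> nu by (auto simp: c3 c2 Cnu intro: add_pos_nonneg)
  \<comment> \<open>The coefficient of the additive \<open>\<sigma>\<^sup>2\<close> term in the risk
    bound. On the good event a loss above the threshold forces \<open>M \<le> K\<close>, hence
    \<open>exp K * exp (- M) \<ge> 1\<close>; this is where \<open>H1 = exp K\<close> comes
    from.\<close>
  define K where "K = 1 / \<alpha> * (C\<^sub>\<nu> / c2)"
  have bounds:
    "(\<integral>\<^sup>+ \<omega>. ennreal (post_param proc \<kappa> \<sigma> n (PZ n) Ihat (obs \<phi> n X \<omega>)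
        {\<theta>' \<in> ell2. (l2dist \<theta> \<theta>')\<^sup>2 \<ge> 4 * c3 / \<alpha> * oracle_rate2 \<sigma> n \<theta> + M * \<sigma>\<^sup>2}) \<partial>P f)
      \<le> ennreal (2 * exp (- real n * \<sigma>\<^sup>2 + ln (real n)) + (C\<^sub>\<nu> + 1) * exp (- (c2 * \<alpha> / 8) * M))"
    (is ?param)
    "emeasure (P f) {\<omega> \<in> space (P f). (l2dist (estimator proc \<kappa> \<sigma> n Ihat (obs \<phi> n X \<omega>)) \<theta>)\<^sup>2
        \<ge> 1 / \<alpha> * c3 * oracle_rate2 \<sigma> n \<theta> + M * \<sigma>\<^sup>2}
      \<le> ennreal (2 * exp (- real n * \<sigma>\<^sup>2 + ln (real n)) + exp K * exp (- 1 * M))" (is ?est)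
    "(\<integral>\<^sup>+ \<omega>. ennreal (\<Sum>I | I \<le> n \<and> rate2 \<sigma> I \<theta> \<ge> c3 * oracle_rate2 \<sigma> n \<theta> + M * \<sigma>\<^sup>2.
        post_struct proc \<kappa> \<sigma> n Ihat (obs \<phi> n X \<omega>) I) \<partial>P f)
      \<le> ennreal (2 * exp (- real n * \<sigma>\<^sup>2 + ln (real n)) + C\<^sub>\<nu> * exp (- c2 * M))" (is ?struct)
    "emeasure (P f) {\<omega> \<in> space (P f).
        rhat2 \<sigma> Ihat (obs \<phi> n X \<omega>) \<ge> c3 * oracle_rate2 \<sigma> n \<theta> + (M + 1) * \<sigma>\<^sup>2}
      \<le> ennreal (2 * exp (- real n * \<sigma>\<^sup>2 + ln (real n)) + 1 * exp (- 1 * M))" (is ?rad)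
    "\<theta> \<in> Theta_eb \<sigma> Istar t \<Longrightarrow> emeasure (P f) {\<omega> \<in> space (P f).
        \<theta> \<notin> l2ball (estimator proc \<kappa> \<sigma> n Ihat (obs \<phi> n X \<omega>))
          (sqrt ((t + 1) * (c3 / \<alpha> + C\<^sub>\<nu> / c2 / \<alpha>) * rhat2 \<sigma> Ihat (obs \<phi> n X \<omega>) + (t + 2) * M * \<sigma>\<^sup>2))}
      \<le> ennreal (2 * exp (- real n * \<sigma>\<^sup>2 + ln (real n)) + 1 * exp (- 1 * M))"
    (is "_ \<Longrightarrow> ?ball")
    if n: "n \<ge> 1" and \<sigma>: "0 < \<sigma>" and model: "iid_model n P X"
      and sel: "argmax_selector \<kappa> \<sigma> n Ihat" and orc: "oracle_selector \<tau>0 \<sigma> n Istar"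
      and M: "0 \<le> M" and t: "0 \<le> t" and f: "f \<in> densities_unit" and \<theta>: "\<theta> = basis_coeffs \<phi> f"
    for n \<sigma> and P :: "(real \<Rightarrow> real) \<Rightarrow> 'w measure" and X Ihat Istar proc M t f \<theta>
  proof -
    interpret prob_space "P f" using model f by (auto simp: iid_model_def)
    have Q: "admissible_Z \<alpha> n (PZ n)" using Z n by blast
    have ell2: "\<theta> \<in> ell2"
      using f basis unfolding \<theta> by (intro basis_coeffs_in_ell2) (auto simp: densities_unit_def)
    obtain G where G: "G \<in> events"
      "emeasure (P f) (space (P f) - G) \<le> ennreal (2 * exp (- real n * \<sigma>\<^sup>2 + ln (real n)))"
      and dev: "\<And>\<omega> i. \<omega> \<in> G \<Longrightarrow> i < n \<Longrightarrow> (obs \<phi> n X \<omega> i - \<theta> i)\<^sup>2 \<le> \<sigma>\<^sup>2 / \<alpha>"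
      unfolding \<theta> using obs_concentration[OF basis bounded c \<alpha>(1,3) \<sigma> n model f] by blast
    have conc: "concentrated_obs \<alpha> \<kappa> \<nu> \<sigma> n (obs \<phi> n X \<omega>) \<theta> Ihat" if "\<omega> \<in> G" for \<omega>
      using \<alpha> nu kappa \<sigma> ell2 sel dev[OF that] by unfold_locales
    note off_event = nn_integral_le_off_event[OF G] emeasure_le_off_event[OF G]
    show ?param
    proof (rule off_event(1))
      fix \<omega> assume "\<omega> \<in> G"
      then show "post_param proc \<kappa> \<sigma> n (PZ n) Ihat (obs \<phi> n X \<omega>)
          {\<theta>' \<in> ell2. (l2dist \<theta> \<theta>')\<^sup>2 \<ge> 4 * c3 / \<alpha> * oracle_rate2 \<sigma> n \<theta> + M * \<sigma>\<^sup>2}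
        \<le> (C\<^sub>\<nu> + 1) * exp (- (c2 * \<alpha> / 8) * M)"
        using concentrated_obs.post_param_le[OF conc Q M] unfolding c2 c3 Cnu by blast
    qed (use pos post_param_le_1[OF sel Q] in auto)
    show ?est
    proof (rule off_event(2))
      fix \<omega> assume \<omega>: "\<omega> \<in> G" and
        le: "(l2dist (estimator proc \<kappa> \<sigma> n Ihat (obs \<phi> n X \<omega>)) \<theta>)\<^sup>2
          \<ge> 1 / \<alpha> * c3 * oracle_rate2 \<sigma> n \<theta> + M * \<sigma>\<^sup>2"
      have "(l2dist (estimator proc \<kappa> \<sigma> n Ihat (obs \<phi> n X \<omega>)) \<theta>)\<^sup>2
          \<le> 1 / \<alpha> * (c3 * oracle_rate2 \<sigma> n \<theta>) + \<sigma>\<^sup>2 * K"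
        using concentrated_obs.estimator_risk_le[OF conc[OF \<omega>], of proc]
        unfolding K_def c2 c3 Cnu by blast
      with le have "\<sigma>\<^sup>2 * M \<le> \<sigma>\<^sup>2 * K" by (simp add: mult_ac)
      then have "M \<le> K" using \<sigma> by simp
      then show "1 \<le> exp K * exp (- 1 * M)" by (simp flip: exp_add)
    qed auto
    show ?struct
    proof (rule off_event(1))
      fix \<omega>
      have "(\<Sum>I | I \<le> n \<and> rate2 \<sigma> I \<theta> \<ge> c3 * oracle_rate2 \<sigma> n \<theta> + M * \<sigma>\<^sup>2.
          post_struct proc \<kappa> \<sigma> n Ihat (obs \<phi> n X \<omega>) I)
        \<le> (\<Sum>I\<le>n. post_struct proc \<kappa> \<sigma> n Ihat (obs \<phi> n X \<omega>) I)"
        by (intro sum_mono2) (auto simp: post_struct_nonneg)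
      then show "(\<Sum>I | I \<le> n \<and> rate2 \<sigma> I \<theta> \<ge> c3 * oracle_rate2 \<sigma> n \<theta> + M * \<sigma>\<^sup>2.
          post_struct proc \<kappa> \<sigma> n Ihat (obs \<phi> n X \<omega>) I) \<le> 1"
        by (simp add: sum_post_struct[OF sel])
    next
      fix \<omega> assume "\<omega> \<in> G"
      then show "(\<Sum>I | I \<le> n \<and> rate2 \<sigma> I \<theta> \<ge> c3 * oracle_rate2 \<sigma> n \<theta> + M * \<sigma>\<^sup>2.
          post_struct proc \<kappa> \<sigma> n Ihat (obs \<phi> n X \<omega>) I) \<le> C\<^sub>\<nu> * exp (- c2 * M)"
        using concentrated_obs.sum_weights_bad[OF conc M] unfolding c2 c3 Cnu by blast
    qed (use pos in auto)
    show ?rad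
    proof (rule off_event(2))
      fix \<omega> assume \<omega>: "\<omega> \<in> G" and
        "rhat2 \<sigma> Ihat (obs \<phi> n X \<omega>) \<ge> c3 * oracle_rate2 \<sigma> n \<theta> + (M + 1) * \<sigma>\<^sup>2"
      \<comment> \<open>The extra \<open>\<sigma>\<^sup>2\<close> in the threshold cancels the one
        by which \<open>rhat2\<close> exceeds \<open>\<sigma>\<^sup>2\<close> times the index. The
        event then contradicts the bound on the selected rate unless \<open>M = 0\<close>, where the
        exponential term equals 1.\<close>
      then have "c3 * oracle_rate2 \<sigma> n \<theta> + M * \<sigma>\<^sup>2 \<le> rate2 \<sigma> (Ihat (obs \<phi> n X \<omega>)) \<theta>"
        using tail2_nonneg[OF ell2, of "Ihat (obs \<phi> n X \<omega>)"]
        by (simp add: rhat2_def rate2_def algebra_simps)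
      then have "\<not> 0 < M"
        using concentrated_obs.rate2_Ihat_less[OF conc[OF \<omega>], of M] unfolding c3 by linarith
      then show "1 \<le> 1 * exp (- 1 * M)" using M by simp
    qed auto
    show ?ball if eb: "\<theta> \<in> Theta_eb \<sigma> Istar t"
    proof (rule off_event(2))
      fix \<omega> assume \<omega>: "\<omega> \<in> G" and out:
        "\<theta> \<notin> l2ball (estimator proc \<kappa> \<sigma> n Ihat (obs \<phi> n X \<omega>))
          (sqrt ((t + 1) * (c3 / \<alpha> + C\<^sub>\<nu> / c2 / \<alpha>) * rhat2 \<sigma> Ihat (obs \<phi> n X \<omega>) + (t + 2) * M * \<sigma>\<^sup>2))"
      have "(l2dist (estimator proc \<kappa> \<sigma> n Ihat (obs \<phi> n X \<omega>)) \<theta>)\<^sup>2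
          \<le> (t + 1) * (c3 / \<alpha> + C\<^sub>\<nu> / c2 / \<alpha>) * rhat2 \<sigma> Ihat (obs \<phi> n X \<omega>)"
        using concentrated_obs.risk_le_rhat2[OF conc[OF \<omega>] tau orc eb t, of proc]
        unfolding c2 c3 Cnu by blast
      also have "\<dots> \<le> (t + 1) * (c3 / \<alpha> + C\<^sub>\<nu> / c2 / \<alpha>) * rhat2 \<sigma> Ihat (obs \<phi> n X \<omega>) + (t + 2) * M * \<sigma>\<^sup>2"
        using M t by simp
      \<comment> \<open>Coverage never fails on the good event, so the constants \<open>H2\<close>
        and \<open>m2\<close> can be taken to be 1.\<close>
      finally have "\<theta> \<in> l2ball (estimator proc \<kappa> \<sigma> n Ihat (obs \<phi> n X \<omega>))
          (sqrt ((t + 1) * (c3 / \<alpha> + C\<^sub>\<nu> / c2 / \<alpha>) * rhat2 \<sigma> Ihat (obs \<phi> n X \<omega>) + (t + 2) * M * \<sigma>\<^sup>2))"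
        using ell2 by (simp add: l2ball_def l2dist_commute[of \<theta>] real_le_rsqrt)
      with out show "1 \<le> 1 * exp (- 1 * M)" by contradiction
    qed auto
  qed
  show ?thesis
  proof (intro exI conjI allI impI)
    show "0 < 4 * c3 / \<alpha>" "0 < 1 / \<alpha> * c3" "0 < c3 / \<alpha> + C\<^sub>\<nu> / c2 / \<alpha>" "0 < c3"
      "0 < C\<^sub>\<nu> + 1" "0 < exp K" "0 < (1::real)" "0 < (1::real)"
      "0 < c2 * \<alpha> / 8" "0 < (1::real)" "0 < (1::real)" "0 < (1::real)"
      using pos \<alpha> by (auto intro!: add_pos_pos divide_pos_pos)
  qed (use bounds in \<open>auto intro!: SUP_least\<close>)
qed

end
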